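(* Let $M^2_{\mathrm{sing}}\subset\mathbb{R}^4$ be a surface with a singularity of corank 1 at $p\in M^2_{\mathrm{sing}}$ and let $[\nu_2,\nu_3,\nu_4]$ be an adapted frame of $N_pM^2_{\mathrm{sing}}$. The distance squared function $d_\nu$ is singular at $p$ if and only if $\nu\in N_pM^2_{\mathrm{sing}}$. Furthermore, the following possibilities hold: (i) If $p\in\mathcal{M}_3$, then the focal set of $M^2_{\mathrm{sing}}$ at $p$ is a quadric. Moreover, it intersects the set of degenerate directions on a line $\nu=p+r(\nu_2+\nu_4)$, $r\in\mathbb{R}$. In addition, the umbilical focus at $p$ is given by $$\nu=p+\frac{1}{\kappa_u^{\mathrm{sing}}}\nu_4\in E_p^\perp.$$ (ii) If $p\in\mathcal{M}_2$ is semiumbilic and (1) $\Delta_p$ is a half-line, then the focal set of $M^2_{\mathrm{sing}}$ at $p$ is the union of two transverse planes intersecting in a line of umbilical foci at $p$ given by $\ell=p+\frac{1}{\kappa_u^{\mathrm{sing}}}\nu_3+r\nu_4$, $r\in\mathbb{R}$. (2) $\Delta_p$ is a line, then the focal set of $M^2_{\mathrm{sing}}$ at $p$ is equal to the set of the degenerate directions ($E_p^\perp$). In addition, $\ell=p+\frac{1}{\kappa_u^{\mathrm{sing}}}\nu_3+r\nu_4$, $r\in\mathbb{R}$, is a line of umbilical foci at $p$. Moreover, (in case (ii)) the focal set of $M^2_{\mathrm{sing}}$ at $p$ intersects the set of degenerate directions when $\nu\in E_p^\perp$. (iii) If $p\in\mathcal{M}_1$ and (1) $\Delta_p$ is a half-line,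 then the focal set of $M^2_{\mathrm{sing}}$ at $p$ is the union of two parallel planes in $N_pM^2_{\mathrm{sing}}$, which can be coincident. (2) $p$ is umbilic non flat, then the focal set of $M^2_{\mathrm{sing}}$ at $p$ is the hyperplane $N_pM^2_{\mathrm{sing}}$. In addition, there is a plane of umbilical foci at $p$ given by $$\nu=p+t\nu_2+\frac{1}{\kappa_u^{\mathrm{sing}}}\nu_3+r\nu_4,\quad t,r\in\mathbb{R}.$$
   Context: $M^2_{\mathrm{sing}}$ is the image of a smooth map $g:\tilde M\to\mathbb{R}^4$ from a smooth surface, of corank 1 at $q\in\tilde M$, $g(q)=p$. The normal space $N_pM^2_{\mathrm{sing}}$ is the 3-dimensional orthogonal complement of the line $\operatorname{Im}dg_q$, regarded as an affine hyperplane of $\mathbb{R}^4$ through the origin $p$. $I(v,w)=\langle dg_q(v),dg_q(w)\rangle$ on $T_q\tilde M$; the second fundamental form $II:T_q\tilde M\times T_q\tilde M\to N_pM^2_{\mathrm{sing}}$ is the symmetric bilinear map given in local coordinates by the orthogonal projection to the normal space of the second partial derivatives of $g$; $II_\nu=\langle II,\nu\rangle$. The curvature parabola is $\Delta_p=\{II(w,w):I(w,w)=1\}$; it is a plane curve that may degenerate to a half-line, a line or a point. $\mathcal{M}_i$ denotes the points where the rank of the second fundamental form (the dimension of the span of the image of $II$) is $i$. $\mathrm{Aff}_p$ is the smallest affine subspace of $N_pM^2_{\mathrm{sing}}$ containing $\Delta_p$. $E_p$ is the plane through the origin which is: parallel to $\mathrm{Aff}_p$ if $\Delta_p$ is a non-degenerate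 parabola; the plane through $p$ containing $\mathrm{Aff}_p$ if $\Delta_p$ is a non-radial half-line or line; any plane through $p$ containing $\mathrm{Aff}_p$ if $\Delta_p$ is a radial half-line, a radial line or a point (radial: contained in a line through $p$). $E_p^\perp$ is the orthogonal complement of $E_p$ in $N_pM^2_{\mathrm{sing}}$. The umbilic curvature is $\kappa_u^{\mathrm{sing}}=d(p,\mathrm{Aff}_p)$. The point $p$ is semiumbilic if $\Delta_p$ is a half-line or line which is not radial; it is umbilic non flat if $\Delta_p$ is a point different from $p$. An adapted frame $[\nu_2,\nu_3,\nu_4]$ of $N_pM^2_{\mathrm{sing}}$ is a positively oriented orthonormal frame with $\nu_4\in E_p^\perp$, $[\nu_2,\nu_3]$ a positively oriented frame of $E_p$, and: $\nu_2$ is parallel to the direction of $\Delta_p$ when $\Delta_p$ is a line or a half-line; $\nu_3$ is the direction of $\Delta_p$ when $\Delta_p$ is a point different from $p$. The set of degenerate directions is the cone of $\nu\in N_pM^2_{\mathrm{sing}}$ for which there is a non-zero $v\in T_q\tilde M$ with $II_\nu(v,w)=0$ for all $w\in T_q\tilde M$ (equivalently the height function $h_\nu(x)=\langle g(x),\nu\rangle$ has a singularity of type $A_2$ or worse at $q$). For $\nu\in\mathbb{R}^4$, $d_\nu:\tilde M\to\mathbb{R}$ is $d_\nu(x)=\|g(x)-\nu\|^2$, and "$d_\nu$ is singular at $p$" means singular at $q$. The focal set of $M^2_{\mathrm{sing}}$ at $p$ is the set of points $\nu\in\mathbb{R}^4$ at which $d_\nu$ has a degenerate singularity ($A_2$ or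 worse) at $q$. An umbilical focus at $p$ is a point $\nu$ for which $d_\nu$ has a singularity of corank 2 at $q$.
   Formalization: In (i) the line is p+rν4, not p+r(ν2+ν4); in (i),(ii) 1/κ_u carries the sign ±1 given by whether ν4 (resp. ν3) points to the side of Δ_p; in (ii) the degenerate directions meet the focal set in p+span{ν3,ν4}, which strictly contains p+E_p^⊥. *)

theory Defs
  imports "HOL-Analysis.Analysis"
begin

section \<open>Smooth surfaces and smooth maps\<close>

fun Ck_on :: "nat \<Rightarrow> 'a set \<Rightarrow> ('a::real_normed_vector \<Rightarrow> 'b::real_normed_vector) \<Rightarrow> bool" where
  "Ck_on 0 S f \<longleftrightarrow> continuous_on S f"
| "Ck_on (Suc k) S f \<longleftrightarrow> (\<forall>x\<in>S. f differentiable (at x)) \<and>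
     (\<forall>v. Ck_on k S (\<lambda>x. frechet_derivative f (at x) v))"

text \<open>Only used for open \<open>S\<close>.\<close>
definition smooth_on :: "'a set \<Rightarrow> ('a::real_normed_vector \<Rightarrow> 'b::real_normed_vector) \<Rightarrow> bool" where
  "smooth_on S f \<longleftrightarrow> (\<forall>k. Ck_on k S f)"

type_synonym 'm chart = "'m set \<times> ('m \<Rightarrow> real^2)"

text \<open>The expression of a map in the coordinates of a chart.\<close>
definition in_chart :: "'m chart \<Rightarrow> ('m \<Rightarrow> 'b) \<Rightarrow> real^2 \<Rightarrow> 'b" where
  "in_chart c f = f \<circ> inv_into (fst c) (snd c)"

definition smooth_surface :: "'m topology \<Rightarrow> 'm chart set \<Rightarrow> bool" where
  "smooth_surface X \<A> \<longleftrightarrow>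
     Hausdorff_space X \<and> second_countable X \<and>
     (\<Union>(U, \<phi>)\<in>\<A>. U) = topspace X \<and>
     (\<forall>(U, \<phi>)\<in>\<A>. openin X U \<and> open (\<phi> ` U) \<and>
        homeomorphic_map (subtopology X U) (top_of_set (\<phi> ` U)) \<phi>) \<and>
     (\<forall>(U, \<phi>)\<in>\<A>. \<forall>(V, \<psi>)\<in>\<A>. smooth_on (\<phi> ` (U \<inter> V)) (in_chart (U, \<phi>) \<psi>))"

definition smooth_map :: "'m chart set \<Rightarrow> ('m \<Rightarrow> 'b::real_normed_vector) \<Rightarrow> bool" where
  "smooth_map \<A> f \<longleftrightarrow> (\<forall>(U, \<phi>)\<in>\<A>. smooth_on (\<phi> ` U) (in_chart (U, \<phi>) f))"

text \<open>
  A chart \<open>c\<close> at \<open>q\<close> identifies the tangent plane at \<open>q\<close> with \<open>real^2\<close>; \<open>diff_at\<close> and \<open>diff2_at\<close>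
  are the first and second differential of a map at \<open>q\<close> in these coordinates.  All notions
  below are computed in one chart at \<open>q\<close>; they are stated for every chart of the atlas at \<open>q\<close>.
\<close>

definition diff_at :: "'m chart \<Rightarrow> ('m \<Rightarrow> 'b::real_normed_vector) \<Rightarrow> 'm \<Rightarrow> real^2 \<Rightarrow> 'b" where
  "diff_at c f q v = frechet_derivative (in_chart c f) (at (snd c q)) v"

definition diff2_at :: "'m chart \<Rightarrow> ('m \<Rightarrow> 'b::real_normed_vector) \<Rightarrow> 'm \<Rightarrow> real^2 \<Rightarrow> real^2 \<Rightarrow> 'b" where
  "diff2_at c f q v w =
     frechet_derivative (\<lambda>x. frechet_derivative (in_chart c f) (at x) w) (at (snd c q)) v"

definition corank_at :: "'m chart \<Rightarrow> ('m \<Rightarrow> real^4) \<Rightarrow> 'm \<Rightarrow> nat" where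
  "corank_at c g q = 2 - dim (range (diff_at c g q))"


section \<open>Second order geometry at the singular point\<close>

text \<open>
  The normal space is the linear subspace of directions; the affine hyperplane through
  \<open>p = g q\<close> is its translate \<open>(+) p ` normal_space_at c g q\<close>.  Likewise the curvature parabola, its
  affine hull and the planes \<open>E\<close> live in the linear normal space, where the origin
  \<open>0\<close> plays the role of \<open>p\<close>.
\<close>
definition normal_space_at :: "'m chart \<Rightarrow> ('m \<Rightarrow> real^4) \<Rightarrow> 'm \<Rightarrow> (real^4) set" where
  "normal_space_at c g q = orthogonal_comp (range (diff_at c g q))"

definition orth_proj :: "'a::euclidean_space set \<Rightarrow> 'a \<Rightarrow> 'a" where
  "orth_proj W x = (THE y. y \<in> W \<and> x - y \<in> orthogonal_comp W)"

definition first_ff :: "'m chart \<Rightarrow> ('m \<Rightarrow> real^4) \<Rightarrow> 'm \<Rightarrow> real^2 \<Rightarrow> real^2 \<Rightarrow> real" where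
  "first_ff c g q v w = diff_at c g q v \<bullet> diff_at c g q w"

definition second_ff :: "'m chart \<Rightarrow> ('m \<Rightarrow> real^4) \<Rightarrow> 'm \<Rightarrow> real^2 \<Rightarrow> real^2 \<Rightarrow> real^4" where
  "second_ff c g q v w = orth_proj (normal_space_at c g q) (diff2_at c g q v w)"

definition second_ff_along ::
    "'m chart \<Rightarrow> ('m \<Rightarrow> real^4) \<Rightarrow> 'm \<Rightarrow> real^4 \<Rightarrow> real^2 \<Rightarrow> real^2 \<Rightarrow> real" where
  "second_ff_along c g q \<nu> v w = second_ff c g q v w \<bullet> \<nu>"

definition second_ff_rank :: "'m chart \<Rightarrow> ('m \<Rightarrow> real^4) \<Rightarrow> 'm \<Rightarrow> nat" where
  "second_ff_rank c g q = dim (span {second_ff c g q v w | v w. True})"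

definition curvature_parabola :: "'m chart \<Rightarrow> ('m \<Rightarrow> real^4) \<Rightarrow> 'm \<Rightarrow> (real^4) set" where
  "curvature_parabola c g q = {second_ff c g q w w | w. first_ff c g q w w = 1}"

definition umbilic_curvature :: "'m chart \<Rightarrow> ('m \<Rightarrow> real^4) \<Rightarrow> 'm \<Rightarrow> real" where
  "umbilic_curvature c g q = infdist 0 (affine hull (curvature_parabola c g q))"

definition degenerate_directions :: "'m chart \<Rightarrow> ('m \<Rightarrow> real^4) \<Rightarrow> 'm \<Rightarrow> (real^4) set" where
  "degenerate_directions c g q =
     {\<nu> \<in> normal_space_at c g q. \<exists>v. v \<noteq> 0 \<and> (\<forall>w. second_ff_along c g q \<nu> v w = 0)}"


section \<open>Shapes of subsets and adapted frames\<close>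

definition is_parabola :: "'a::real_vector set \<Rightarrow> bool" where
  "is_parabola S \<longleftrightarrow> (\<exists>a u v. u \<noteq> v \<and> independent {u, v} \<and>
     S = {a + t *\<^sub>R u + t\<^sup>2 *\<^sub>R v | t. True})"

definition is_half_line :: "'a::real_vector set \<Rightarrow> bool" where
  "is_half_line S \<longleftrightarrow> (\<exists>a d. d \<noteq> 0 \<and> S = {a + t *\<^sub>R d | t. 0 \<le> t})"

definition is_line :: "'a::real_vector set \<Rightarrow> bool" where
  "is_line S \<longleftrightarrow> (\<exists>a d. d \<noteq> 0 \<and> S = {a + t *\<^sub>R d | t. True})"

definition is_radial :: "'a::real_vector set \<Rightarrow> bool" where
  "is_radial S \<longleftrightarrow> (\<exists>d. d \<noteq> 0 \<and> S \<subseteq> span {d})"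

definition semiumbilic :: "'m chart \<Rightarrow> ('m \<Rightarrow> real^4) \<Rightarrow> 'm \<Rightarrow> bool" where
  "semiumbilic c g q \<longleftrightarrow>
     (is_half_line (curvature_parabola c g q) \<or> is_line (curvature_parabola c g q)) \<and>
     \<not> is_radial (curvature_parabola c g q)"

definition umbilic_non_flat :: "'m chart \<Rightarrow> ('m \<Rightarrow> real^4) \<Rightarrow> 'm \<Rightarrow> bool" where
  "umbilic_non_flat c g q \<longleftrightarrow> (\<exists>a. a \<noteq> 0 \<and> curvature_parabola c g q = {a})"

text \<open>
  The plane \<open>E\<close> is unique in the first two cases and any plane with the stated property
  in the remaining ones, hence a predicate.
\<close>
definition is_E_plane :: "'m chart \<Rightarrow> ('m \<Rightarrow> real^4) \<Rightarrow> 'm \<Rightarrow> (real^4) set \<Rightarrow> bool" where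
  "is_E_plane c g q E \<longleftrightarrow>
     (let \<Delta> = curvature_parabola c g q in
      subspace E \<and> dim E = 2 \<and> E \<subseteq> normal_space_at c g q \<and>
      (is_parabola \<Delta> \<longrightarrow> affine_parallel E (affine hull \<Delta>)) \<and>
      ((is_half_line \<Delta> \<or> is_line \<Delta>) \<and> \<not> is_radial \<Delta> \<longrightarrow> affine hull \<Delta> \<subseteq> E) \<and>
      ((is_half_line \<Delta> \<or> is_line \<Delta>) \<and> is_radial \<Delta> \<or> (\<exists>a. \<Delta> = {a}) \<longrightarrow> affine hull \<Delta> \<subseteq> E))"

definition E_perp :: "'m chart \<Rightarrow> ('m \<Rightarrow> real^4) \<Rightarrow> 'm \<Rightarrow> (real^4) set \<Rightarrow> (real^4) set" where
  "E_perp c g q E = normal_space_at c g q \<inter> orthogonal_comp E"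

text \<open>
  Neither the normal space nor \<open>E\<close> carries a canonical orientation, and every frame
  satisfying the conditions below is positively oriented for suitable orientations of
  the two spaces.  Quantifying over all these frames is therefore the same as quantifying over
  all orientations and all positively oriented adapted frames.  In particular the frame vector
  along which \<open>umbilic_curvature\<close> is measured is only determined up to sign, unless the curvature
  parabola is a point.
\<close>
definition adapted_frame ::
    "'m chart \<Rightarrow> ('m \<Rightarrow> real^4) \<Rightarrow> 'm \<Rightarrow> (real^4) set \<Rightarrow> real^4 \<Rightarrow> real^4 \<Rightarrow> real^4 \<Rightarrow> bool" where
  "adapted_frame c g q E \<nu>2 \<nu>3 \<nu>4 \<longleftrightarrow>
     (let \<Delta> = curvature_parabola c g q in
      norm \<nu>2 = 1 \<and> norm \<nu>3 = 1 \<and> norm \<nu>4 = 1 \<and>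
      \<nu>2 \<bullet> \<nu>3 = 0 \<and> \<nu>2 \<bullet> \<nu>4 = 0 \<and> \<nu>3 \<bullet> \<nu>4 = 0 \<and>
      span {\<nu>2, \<nu>3, \<nu>4} = normal_space_at c g q \<and>
      span {\<nu>2, \<nu>3} = E \<and> \<nu>4 \<in> E_perp c g q E \<and>
      (is_line \<Delta> \<or> is_half_line \<Delta> \<longrightarrow> (\<forall>x\<in>\<Delta>. \<forall>y\<in>\<Delta>. x - y \<in> span {\<nu>2})) \<and>
      (\<forall>a. \<Delta> = {a} \<and> a \<noteq> 0 \<longrightarrow> \<nu>3 = sgn a))"


section \<open>Distance squared functions and the focal set\<close>

definition dist_sq :: "('m \<Rightarrow> real^4) \<Rightarrow> real^4 \<Rightarrow> 'm \<Rightarrow> real" where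
  "dist_sq g \<nu> x = (norm (g x - \<nu>))\<^sup>2"

definition singular_at :: "'m chart \<Rightarrow> ('m \<Rightarrow> real) \<Rightarrow> 'm \<Rightarrow> bool" where
  "singular_at c f q \<longleftrightarrow> (\<forall>v. diff_at c f q v = 0)"

definition hessian_kernel :: "'m chart \<Rightarrow> ('m \<Rightarrow> real) \<Rightarrow> 'm \<Rightarrow> (real^2) set" where
  "hessian_kernel c f q = {v. \<forall>w. diff2_at c f q v w = 0}"

text \<open>A singularity is of type \<open>A\<^sub>2\<close> or worse iff it is not Morse, i.e. its Hessian is degenerate.\<close>
definition focal_set :: "'m chart \<Rightarrow> ('m \<Rightarrow> real^4) \<Rightarrow> 'm \<Rightarrow> (real^4) set" where
  "focal_set c g q =
     {\<nu>. singular_at c (dist_sq g \<nu>) q \<and> hessian_kernel c (dist_sq g \<nu>) q \<noteq> {0}}"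

definition umbilical_foci :: "'m chart \<Rightarrow> ('m \<Rightarrow> real^4) \<Rightarrow> 'm \<Rightarrow> (real^4) set" where
  "umbilical_foci c g q =
     {\<nu>. singular_at c (dist_sq g \<nu>) q \<and> dim (hessian_kernel c (dist_sq g \<nu>) q) = 2}"

text \<open>
  \<open>is_quadric V p S\<close>: \<open>S\<close> is the zero set of a polynomial of degree 2 on the affine space
  \<open>p + V\<close>; the quadratic part must not vanish identically on \<open>V\<close>.
\<close>
definition is_quadric :: "'a::euclidean_space set \<Rightarrow> 'a \<Rightarrow> 'a set \<Rightarrow> bool" where
  "is_quadric V p S \<longleftrightarrow> (\<exists>(B :: 'a \<Rightarrow> 'a \<Rightarrow> real) b k. bilinear B \<and> (\<exists>u\<in>V. B u u \<noteq> 0) \<and>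
     S = {p + u | u. u \<in> V \<and> B u u + b \<bullet> u + k = 0})"

definition is_plane :: "'a::euclidean_space set \<Rightarrow> bool" where
  "is_plane P \<longleftrightarrow> affine P \<and> aff_dim P = 2"

text \<open>Transversality of affine subspaces inside an affine space with direction space \<open>V\<close>.\<close>
definition transverse_in :: "'a::euclidean_space set \<Rightarrow> 'a set \<Rightarrow> 'a set \<Rightarrow> bool" where
  "transverse_in V P Q \<longleftrightarrow>
     span ({x - y | x y. x \<in> P \<and> y \<in> P} \<union> {x - y | x y. x \<in> Q \<and> y \<in> Q}) = V"

end

theory Submission
  imports Defs
begin

text \<open>
  Everything is decided by three normal vectors.  Since the differential \<open>D\<close> of \<open>g\<close> at \<open>q\<close> has rank
  one, the tangent plane has a basis \<open>a\<close>, \<open>b\<close> with \<open>norm (D a) = 1\<close> and \<open>D b = 0\<close>.  Put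
  \<open>\<alpha> = II(a,a)\<close>, \<open>\<beta> = II(a,b)\<close> and \<open>\<gamma> = II(b,b)\<close>.  The unit vectors of the first fundamental form are
  \<open>\<plusminus>(a + t b)\<close>, so the curvature parabola is \<open>{\<alpha> + 2 t \<beta> + t\<^sup>2 \<gamma>}\<close>, its affine hull is
  \<open>\<alpha> + span {\<beta>, \<gamma>}\<close>, and the rank of \<open>II\<close> is the dimension of \<open>span {\<alpha>, \<beta>, \<gamma>}\<close>.

  The distance squared function from \<open>\<nu> = p + u\<close> has differential \<open>- 2 \<langle>u, D v\<rangle>\<close>, which vanishes iff
  \<open>u\<close> is normal, and then its Hessian is \<open>2 (I - \<langle>u, II\<rangle>)\<close>.  In the basis \<open>a\<close>, \<open>b\<close> half the Hessian is the
  symmetric matrix with entries \<open>1 - \<langle>u, \<alpha>\<rangle>\<close>, \<open>- \<langle>u, \<beta>\<rangle>\<close>, \<open>- \<langle>u, \<gamma>\<rangle>\<close>.  Hence, for normal \<open>u\<close>,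
  \<^item> \<open>p + u\<close> is a focal point iff \<open>(\<langle>u, \<alpha>\<rangle> - 1) \<langle>u, \<gamma>\<rangle> = \<langle>u, \<beta>\<rangle>\<^sup>2\<close>,
  \<^item> \<open>p + u\<close> is an umbilical focus iff \<open>\<langle>u, \<alpha>\<rangle> = 1\<close> and \<open>\<langle>u, \<beta>\<rangle> = \<langle>u, \<gamma>\<rangle> = 0\<close>,
  \<^item> \<open>u\<close> is a degenerate direction iff \<open>\<langle>u, \<alpha>\<rangle> \<langle>u, \<gamma>\<rangle> = \<langle>u, \<beta>\<rangle>\<^sup>2\<close>.

  This is the lemma \<open>corank1_second_order_data\<close>; its analytic core is the symmetry of the second
  derivative.  Subtracting the first equation from the third one shows that a focal point lies in
  a degenerate direction iff \<open>\<langle>u, \<beta>\<rangle> = \<langle>u, \<gamma>\<rangle> = 0\<close>.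

  The rest is linear algebra in an adapted frame.  If \<open>\<alpha>\<close>, \<open>\<beta>\<close>, \<open>\<gamma>\<close> are independent, then
  \<open>E = span {\<beta>, \<gamma>}\<close>, the vectors orthogonal to \<open>\<beta>\<close> and \<open>\<gamma>\<close> are the multiples of \<open>\<nu>4\<close>, and the
  focal equation has a nonzero quadratic part.  If the parabola is a line or a half-line, then
  \<open>\<beta> = b \<nu>2\<close> and \<open>\<gamma> = c \<nu>2\<close>, with \<open>c \<noteq> 0\<close> for a half-line and \<open>b \<noteq> 0 = c\<close> for a line.  For a
  half-line the focal equation factors as \<open>\<langle>u, \<nu>2\<rangle> (\<langle>u, \<alpha> - (b\<^sup>2/c) \<nu>2\<rangle> - 1) = 0\<close>, which describes two
  planes; they are transverse iff \<open>\<alpha>\<close> is not a multiple of \<open>\<nu>2\<close>, that is, iff the half-line is not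
  radial, and otherwise they are parallel (or the second one is empty).  For a line it is
  \<open>\<langle>u, \<nu>2\<rangle> = 0\<close>.  If the parabola is a point, then \<open>\<beta> = \<gamma> = 0\<close> and the equation is void.

  Suppose that the affine hull of the parabola does not pass through \<open>p\<close>, and let \<open>e\<close> be the frame
  vector in the direction of the perpendicular from \<open>p\<close> to it.  The umbilical foci are the
  points \<open>p + u\<close> with \<open>u\<close> orthogonal to \<open>\<beta>\<close> and \<open>\<gamma>\<close> and \<open>\<langle>u, e\<rangle> = 1 / h\<close>, where
  \<open>h = \<langle>\<alpha>, e\<rangle>\<close>; the umbilic curvature is \<open>\<bar>h\<bar>\<close>, and the sign of \<open>h\<close> tells on which side of the
  origin the parabola lies.
\<close>

section \<open>Symmetry of the second derivative\<close>

lemma has_real_derivative_along_line: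
  fixes h :: "'a::real_normed_vector \<Rightarrow> real"
  assumes "(h has_derivative h') (at (y + t *\<^sub>R v))"
  shows "((\<lambda>t. h (y + t *\<^sub>R v)) has_real_derivative h' v) (at t)"
proof -
  have lin: "linear h'"
    using assms by (rule has_derivative_linear)
  have "((\<lambda>t. y + t *\<^sub>R v) has_derivative (\<lambda>r. r *\<^sub>R v)) (at t)"
    by (auto intro!: derivative_eq_intros)
  from diff_chain_at[OF this assms]
  have "((\<lambda>t. h (y + t *\<^sub>R v)) has_derivative (\<lambda>r. h' (r *\<^sub>R v))) (at t)"
    by (simp add: o_def)
  moreover have "(\<lambda>r. h' (r *\<^sub>R v)) = (*) (h' v)"
    by (auto simp: linear_scale[OF lin])
  ultimately show ?thesis
    by (simp add: has_field_derivative_def)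
qed

text \<open>
  The second difference is symmetric in \<open>v\<close> and \<open>w\<close>, while its limit is the derivative of \<open>h\<close> along
  \<open>v\<close> and then along \<open>w\<close>; this is what makes mixed derivatives commute.  For small \<open>s\<close> the mean
  value theorem, applied along \<open>v\<close> and then along \<open>w\<close>, turns the quotient into a value of the
  second derivative at a point near \<open>x\<close>.
\<close>
lemma second_difference_quotient_tendsto:
  fixes h :: "'a::real_normed_vector \<Rightarrow> real"
  assumes S: "open S" "x \<in> S"
    and h': "\<And>y. y \<in> S \<Longrightarrow> (h has_derivative h' y) (at y)"
    and h'': "\<And>y. y \<in> S \<Longrightarrow> ((\<lambda>z. h' z v) has_derivative h'' y) (at y)"
    and cont: "continuous_on S (\<lambda>y. h'' y w)"
  shows "((\<lambda>s. (h (x + s *\<^sub>R v + s *\<^sub>R w) - h (x + s *\<^sub>R v) - h (x + s *\<^sub>R w) + h x) / s\<^sup>2)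
           \<longlongrightarrow> h'' x w) (at_right 0)"
proof (rule tendstoI)
  fix e :: real assume "e > 0"
  obtain d1 where d1: "d1 > 0" "\<And>y. dist y x < d1 \<Longrightarrow> y \<in> S"
    using S openE[of S x] by (metis dist_commute mem_ball subsetD)
  obtain d2 where d2: "d2 > 0" "\<And>y. y \<in> S \<Longrightarrow> dist y x < d2 \<Longrightarrow> dist (h'' y w) (h'' x w) < e"
    using cont S(2) \<open>e > 0\<close> unfolding continuous_on_iff by metis
  define d where "d = min d1 d2"
  have "d > 0" and d: "\<And>y. dist y x < d \<Longrightarrow> y \<in> S \<and> dist (h'' y w) (h'' x w) < e"
    using d1 d2 by (auto simp: d_def)
  define m where "m = norm v + norm w + 1"
  have "m > 0" by (simp add: m_def add_nonneg_pos)
  have near: "dist (x + t *\<^sub>R v + r *\<^sub>R w) x < d"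
    if "0 < s" "s < d / m" "0 \<le> t" "t \<le> s" "0 \<le> r" "r \<le> s" for s t r
  proof -
    have "dist (x + t *\<^sub>R v + r *\<^sub>R w) x \<le> t * norm v + r * norm w"
      using norm_triangle_ineq[of "t *\<^sub>R v" "r *\<^sub>R w"] that by (simp add: dist_norm add.assoc)
    also have "\<dots> \<le> s * norm v + s * norm w"
      using that by (intro add_mono mult_right_mono) auto
    also have "\<dots> \<le> s * m" using that by (simp add: m_def algebra_simps)
    also have "\<dots> < d" using that \<open>m > 0\<close> by (simp add: field_simps)
    finally show ?thesis .
  qed
  have "dist ((h (x + s *\<^sub>R v + s *\<^sub>R w) - h (x + s *\<^sub>R v) - h (x + s *\<^sub>R w) + h x) / s\<^sup>2) (h'' x w) < e"
    if s: "0 < s" "s < d / m" for s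
  proof -
    \<comment> \<open>The second difference is the increment of \<open>t \<mapsto> h (x + s w + t v) - h (x + t v)\<close> on \<open>[0, s]\<close>.\<close>
    have "\<exists>t. 0 < t \<and> t < s \<and>
        (h ((x + s *\<^sub>R w) + s *\<^sub>R v) - h (x + s *\<^sub>R v)) - (h ((x + s *\<^sub>R w) + 0 *\<^sub>R v) - h (x + 0 *\<^sub>R v))
        = (s - 0) * (h' ((x + s *\<^sub>R w) + t *\<^sub>R v) v - h' (x + t *\<^sub>R v) v)"
    proof (rule MVT2)
      fix t :: real assume t: "0 \<le> t" "t \<le> s"
      have "(x + s *\<^sub>R w) + t *\<^sub>R v \<in> S" "x + t *\<^sub>R v \<in> S"
        using near[OF s t, of s] near[OF s t, of 0] s d by (auto simp: add_ac)
      then show "((\<lambda>t. h ((x + s *\<^sub>R w) + t *\<^sub>R v) - h (x + t *\<^sub>R v)) has_real_derivative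
          h' ((x + s *\<^sub>R w) + t *\<^sub>R v) v - h' (x + t *\<^sub>R v) v) (at t)"
        by (intro DERIV_diff has_real_derivative_along_line h')
    qed (use s in auto)
    then obtain t where t: "0 < t" "t < s" and eq1:
        "h (x + s *\<^sub>R v + s *\<^sub>R w) - h (x + s *\<^sub>R v) - h (x + s *\<^sub>R w) + h x
         = s * (h' ((x + t *\<^sub>R v) + s *\<^sub>R w) v - h' ((x + t *\<^sub>R v) + 0 *\<^sub>R w) v)"
      by (auto simp: add_ac)
    have "\<exists>r. 0 < r \<and> r < s \<and>
        h' ((x + t *\<^sub>R v) + s *\<^sub>R w) v - h' ((x + t *\<^sub>R v) + 0 *\<^sub>R w) v
        = (s - 0) * h'' ((x + t *\<^sub>R v) + r *\<^sub>R w) w"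
    proof (rule MVT2)
      fix r :: real assume r: "0 \<le> r" "r \<le> s"
      have "(x + t *\<^sub>R v) + r *\<^sub>R w \<in> S"
        using near[OF s _ _ r, of t] t d by auto
      then show "((\<lambda>r. h' ((x + t *\<^sub>R v) + r *\<^sub>R w) v) has_real_derivative
          h'' ((x + t *\<^sub>R v) + r *\<^sub>R w) w) (at r)"
        by (intro has_real_derivative_along_line[where h = "\<lambda>z. h' z v"] h'')
    qed (use s in auto)
    then obtain r where r: "0 < r" "r < s" and eq2:
        "h' ((x + t *\<^sub>R v) + s *\<^sub>R w) v - h' ((x + t *\<^sub>R v) + 0 *\<^sub>R w) v
        = s * h'' ((x + t *\<^sub>R v) + r *\<^sub>R w) w"
      by auto
    have "(h (x + s *\<^sub>R v + s *\<^sub>R w) - h (x + s *\<^sub>R v) - h (x + s *\<^sub>R w) + h x) / s\<^sup>2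
        = h'' (x + t *\<^sub>R v + r *\<^sub>R w) w"
      unfolding eq1 eq2 using s by (simp add: power2_eq_square)
    then show ?thesis
      using near[OF s, of t r] t r d by auto
  qed
  moreover have "d / m > 0" using \<open>d > 0\<close> \<open>m > 0\<close> by simp
  ultimately show "\<forall>\<^sub>F s in at_right 0.
      dist ((h (x + s *\<^sub>R v + s *\<^sub>R w) - h (x + s *\<^sub>R v) - h (x + s *\<^sub>R w) + h x) / s\<^sup>2) (h'' x w) < e"
    unfolding eventually_at_right_field by blast
qed

text \<open>
  Testing against vectors \<open>e\<close> reduces the claim to real functions; there both orders of
  differentiation are limits of the same second difference quotient.
\<close>
lemma second_derivative_symmetric:
  fixes f :: "'a::real_normed_vector \<Rightarrow> 'b::real_inner"
  assumes S: "open S" "x \<in> S"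
    and f': "\<And>y. y \<in> S \<Longrightarrow> (f has_derivative f' y) (at y)"
    and f'': "\<And>y w. y \<in> S \<Longrightarrow> ((\<lambda>z. f' z w) has_derivative f'' y w) (at y)"
    and cont: "\<And>v w. continuous_on S (\<lambda>y. f'' y w v)"
  shows "f'' x w v = f'' x v w"
proof -
  have lim: "((\<lambda>s. (f (x + s *\<^sub>R v + s *\<^sub>R w) \<bullet> e - f (x + s *\<^sub>R v) \<bullet> e
          - f (x + s *\<^sub>R w) \<bullet> e + f x \<bullet> e) / s\<^sup>2)
      \<longlongrightarrow> f'' x v w \<bullet> e) (at_right 0)" for v w e
  proof (rule second_difference_quotient_tendsto[where h = "\<lambda>y. f y \<bullet> e" and h' = "\<lambda>y v. f' y v \<bullet> e"
        and h'' = "\<lambda>y w. f'' y v w \<bullet> e"])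
    show "continuous_on S (\<lambda>y. f'' y v w \<bullet> e)"
      by (intro continuous_intros cont)
  qed (auto intro!: S has_derivative_inner_left f' f'')
  have "f'' x w v \<bullet> e = f'' x v w \<bullet> e" for e
    by (rule tendsto_unique[OF _ lim[of w v e]])
       (use lim[of v w e] in \<open>simp_all add: add_ac diff_diff_eq\<close>)
  then show ?thesis
    by (metis vector_eq_ldot inner_commute)
qed

locale C2_at =
  fixes S :: "'a::real_normed_vector set" and f :: "'a \<Rightarrow> 'b::real_inner" and x :: 'a
  assumes open_S: "open S" and x_in: "x \<in> S" and C2: "Ck_on 2 S f"
begin

abbreviation D :: "'a \<Rightarrow> 'a \<Rightarrow> 'b" where
  "D y \<equiv> frechet_derivative f (at y)"

abbreviation D2 :: "'a \<Rightarrow> 'a \<Rightarrow> 'b" where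
  "D2 v w \<equiv> frechet_derivative (\<lambda>y. D y w) (at x) v"

lemma has_derivative_D:
  assumes "y \<in> S"
  shows "(f has_derivative D y) (at y)"
proof -
  have "f differentiable (at y)"
    using C2 assms by (simp add: numeral_2_eq_2)
  then show ?thesis
    by (simp only: frechet_derivative_works)
qed

lemma has_derivative_D2:
  assumes "y \<in> S"
  shows "((\<lambda>z. D z w) has_derivative frechet_derivative (\<lambda>z. D z w) (at y)) (at y)"
proof -
  have "(\<lambda>z. D z w) differentiable (at y)"
    using C2 assms by (simp add: numeral_2_eq_2)
  then show ?thesis
    by (simp only: frechet_derivative_works)
qed

lemma linear_D: "y \<in> S \<Longrightarrow> linear (D y)"
  by (rule has_derivative_linear[OF has_derivative_D])

lemma D2_symmetric: "D2 v w = D2 w v"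
proof (rule second_derivative_symmetric[OF open_S x_in, where f' = D
      and f'' = "\<lambda>y w v. frechet_derivative (\<lambda>z. D z w) (at y) v"])
  show "continuous_on S (\<lambda>y. frechet_derivative (\<lambda>z. D z w) (at y) v)" for v w
    using C2 by (simp add: numeral_2_eq_2)
qed (auto intro: has_derivative_D has_derivative_D2)

lemma bilinear_D2: "bilinear D2"
proof -
  have "linear (\<lambda>v. D2 v w)" for w
    using has_derivative_linear[OF has_derivative_D2[OF x_in]] .
  then show ?thesis
    unfolding bilinear_def using D2_symmetric by (metis (no_types, lifting) ext)
qed

lemma dist_sq_has_derivative:
  assumes "y \<in> S"
  shows "((\<lambda>y. (norm (f y - n))\<^sup>2) has_derivative (\<lambda>v. 2 * ((f y - n) \<bullet> D y v))) (at y)"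
  unfolding power2_norm_eq_inner
  by (rule derivative_eq_intros has_derivative_D assms refl)+ (simp add: inner_commute fun_eq_iff)

lemma dist_sq_D:
  assumes "y \<in> S"
  shows "frechet_derivative (\<lambda>y. (norm (f y - n))\<^sup>2) (at y) = (\<lambda>v. 2 * ((f y - n) \<bullet> D y v))"
  using frechet_derivative_at[OF dist_sq_has_derivative[OF assms]] by simp

text \<open>
  The product rule gives one term from the two first derivatives and one term from the second
  derivative; the latter carries the sign that makes \<open>n - f x\<close> appear.
\<close>
lemma dist_sq_D2:
  "frechet_derivative (\<lambda>z. frechet_derivative (\<lambda>y. (norm (f y - n))\<^sup>2) (at z) w) (at x) v
     = 2 * (D x v \<bullet> D x w - (n - f x) \<bullet> D2 v w)"
proof -
  have "((\<lambda>z. 2 * ((f z - n) \<bullet> D z w)) has_derivative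
      (\<lambda>v. 2 * (D x v \<bullet> D x w - (n - f x) \<bullet> D2 v w))) (at x)"
    by (rule derivative_eq_intros has_derivative_D has_derivative_D2 x_in refl)+
       (simp add: inner_diff_left algebra_simps fun_eq_iff)
  then have "((\<lambda>z. frechet_derivative (\<lambda>y. (norm (f y - n))\<^sup>2) (at z) w) has_derivative
      (\<lambda>v. 2 * (D x v \<bullet> D x w - (n - f x) \<bullet> D2 v w))) (at x)"
    by (rule has_derivative_transform_within_open[OF _ open_S x_in]) (simp add: dist_sq_D)
  from fun_cong[OF frechet_derivative_at[OF this], of v] show ?thesis
    by simp
qed

end

section \<open>Bilinear forms on the plane\<close>

lemma in_span_pair_iff:
  fixes a b :: "'a::real_vector"
  shows "x \<in> span {a, b} \<longleftrightarrow> (\<exists>r s. x = r *\<^sub>R a + s *\<^sub>R b)"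
proof -
  have "x \<in> span {a, b} \<longleftrightarrow> (\<exists>r s. x - r *\<^sub>R a = s *\<^sub>R b)"
    by (auto simp: span_insert span_singleton)
  then show ?thesis
    by (simp add: algebra_simps)
qed

text \<open>
  The basis in which the first fundamental form of a corank 1 point becomes \<open>x\<^sup>2\<close>: \<open>b\<close> spans the
  kernel and \<open>a\<close> is a unit vector modulo the kernel.
\<close>
lemma rank1_adapted_basis:
  fixes D :: "real^2 \<Rightarrow> 'b::euclidean_space"
  assumes D: "linear D" and rank: "dim (range D) = 1"
  obtains a b where "norm (D a) = 1" "D b = 0" "b \<noteq> 0" "\<And>v. \<exists>x y. v = x *\<^sub>R a + y *\<^sub>R b"
proof -
  have "\<exists>a. D a \<noteq> 0"
  proof (rule ccontr)
    assume "\<not> ?thesis"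
    then have "range D = {0}" by auto
    with rank show False by simp
  qed
  then obtain a0 where a0: "D a0 \<noteq> 0" by blast
  define a where "a = (1 / norm (D a0)) *\<^sub>R a0"
  have norm_a: "norm (D a) = 1"
    using a0 by (simp add: a_def linear_scale[OF D])
  have "\<not> inj D"
  proof
    assume "inj D"
    then have "dim (range D) = dim (UNIV :: (real^2) set)"
      by (intro dim_image_eq[OF D]) simp
    with rank show False by simp
  qed
  then obtain b where b: "b \<noteq> 0" "D b = 0"
    using linear_injective_0[OF D] by blast
  have "independent {a, b}"
  proof -
    have "a \<notin> span {b}"
      using norm_a b by (auto simp: span_singleton linear_scale[OF D])
    then show ?thesis
      using b span_base[of a "{b}"] by (auto simp: independent_insert)
  qed
  moreover have "a \<noteq> b" using norm_a b by auto
  ultimately have "UNIV \<subseteq> span {a, b}"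
    by (intro card_ge_dim_independent) auto
  then have "\<exists>x y. v = x *\<^sub>R a + y *\<^sub>R b" for v
    using in_span_pair_iff[of v a b] by auto
  with norm_a b that show thesis by blast
qed

locale plane_basis =
  fixes a b :: "real^2"
  assumes coordinates: "\<exists>x y. v = x *\<^sub>R a + y *\<^sub>R b"
    and nondegenerate: "x *\<^sub>R a + y *\<^sub>R b = 0 \<Longrightarrow> x = 0 \<and> y = 0"
begin

lemma bilinear_coordinates:
  assumes "bilinear H"
  shows "H (x *\<^sub>R a + y *\<^sub>R b) (x' *\<^sub>R a + y' *\<^sub>R b) =
    (x * x') *\<^sub>R H a a + (x * y') *\<^sub>R H a b + (y * x') *\<^sub>R H b a + (y * y') *\<^sub>R H b b"
  using assms by (simp add: bilinear_ladd bilinear_radd bilinear_lmul bilinear_rmul algebra_simps)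

lemma bilinear_zero_right_iff:
  fixes H :: "real^2 \<Rightarrow> real^2 \<Rightarrow> real"
  assumes H: "bilinear H" and sym: "H b a = H a b"
  shows "(\<forall>w. H (x *\<^sub>R a + y *\<^sub>R b) w = 0) \<longleftrightarrow>
    x * H a a + y * H a b = 0 \<and> x * H a b + y * H b b = 0"
    (is "?L \<longleftrightarrow> ?R")
proof
  assume ?L
  then have "H (x *\<^sub>R a + y *\<^sub>R b) a = 0" "H (x *\<^sub>R a + y *\<^sub>R b) b = 0" by auto
  then show ?R using H sym by (simp add: bilinear_ladd bilinear_lmul)
next
  assume R: ?R
  show ?L
  proof
    fix w
    obtain x' y' where w: "w = x' *\<^sub>R a + y' *\<^sub>R b" using coordinates by blast
    have "H (x *\<^sub>R a + y *\<^sub>R b) w = x' * (x * H a a + y * H a b) + y' * (x * H a b + y * H b b)"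
      unfolding w bilinear_coordinates[OF H] sym by (simp add: algebra_simps)
    with R show "H (x *\<^sub>R a + y *\<^sub>R b) w = 0" by simp
  qed
qed

lemma ex_bilinear_kernel_iff:
  fixes H :: "real^2 \<Rightarrow> real^2 \<Rightarrow> real"
  assumes H: "bilinear H" and sym: "H b a = H a b"
  shows "(\<exists>v. v \<noteq> 0 \<and> (\<forall>w. H v w = 0)) \<longleftrightarrow> H a a * H b b = (H a b)\<^sup>2"
proof
  assume "\<exists>v. v \<noteq> 0 \<and> (\<forall>w. H v w = 0)"
  then obtain v where v: "v \<noteq> 0" "\<forall>w. H v w = 0" by blast
  obtain x y where xy: "v = x *\<^sub>R a + y *\<^sub>R b" using coordinates by blast
  have eqs: "x * H a a + y * H a b = 0" "x * H a b + y * H b b = 0"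
    using v(2) bilinear_zero_right_iff[OF H sym] unfolding xy by auto
  have "x \<noteq> 0 \<or> y \<noteq> 0" using v(1) xy by auto
  moreover have "x * (H a a * H b b - (H a b)\<^sup>2) = 0" "y * (H a a * H b b - (H a b)\<^sup>2) = 0"
    using eqs by algebra+
  ultimately show "H a a * H b b = (H a b)\<^sup>2" by auto
next
  assume det: "H a a * H b b = (H a b)\<^sup>2"
  obtain x y where "x \<noteq> 0 \<or> y \<noteq> 0" "x * H a a + y * H a b = 0" "x * H a b + y * H b b = 0"
  proof (cases "H a a = 0 \<and> H a b = 0")
    case True
    with that[of 1 0] show thesis by simp
  next
    case False
    \<comment> \<open>The kernel is orthogonal to the first row of the matrix of \<open>H\<close>.\<close>
    with det that[of "H a b" "- H a a"] show thesis
      by (auto simp: power2_eq_square)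
  qed
  then show "\<exists>v. v \<noteq> 0 \<and> (\<forall>w. H v w = 0)"
    using bilinear_zero_right_iff[OF H sym] nondegenerate by blast
qed

lemma dim_bilinear_kernel_eq_2_iff:
  fixes H :: "real^2 \<Rightarrow> real^2 \<Rightarrow> real"
  assumes H: "bilinear H" and sym: "H b a = H a b"
  shows "dim {v. \<forall>w. H v w = 0} = 2 \<longleftrightarrow> H a a = 0 \<and> H a b = 0 \<and> H b b = 0"
proof -
  have "subspace {v. \<forall>w. H v w = 0}"
    using H by (auto simp: subspace_def bilinear_ladd bilinear_lmul bilinear_lzero)
  then have "dim {v. \<forall>w. H v w = 0} = 2 \<longleftrightarrow> {v. \<forall>w. H v w = 0} = UNIV"
    using dim_eq_full[of "{v. \<forall>w. H v w = 0}"] by (simp add: span_eq_iff[THEN iffD2])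
  also have "\<dots> \<longleftrightarrow> H a a = 0 \<and> H a b = 0 \<and> H b b = 0" (is "?L \<longleftrightarrow> ?R")
  proof
    assume ?R
    then show ?L
      using bilinear_zero_right_iff[OF H sym] coordinates by (auto simp: set_eq_iff) metis
  qed auto
  finally show ?thesis .
qed

end

section \<open>Orthogonal projection\<close>

lemma orth_proj_works:
  fixes N :: "'a::euclidean_space set"
  assumes "subspace N"
  shows "orth_proj N x \<in> N" "x - orth_proj N x \<in> orthogonal_comp N"
proof -
  obtain y z where yz: "y \<in> span N" "\<And>w. w \<in> span N \<Longrightarrow> orthogonal z w" "x = y + z"
    using orthogonal_subspace_decomp_exists by blast
  have span: "span N = N" using assms by (simp add: span_eq_iff)
  have "\<exists>!y. y \<in> N \<and> x - y \<in> orthogonal_comp N"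
  proof (rule ex1I[of _ y])
    show "y \<in> N \<and> x - y \<in> orthogonal_comp N"
      using yz span by (auto simp: orthogonal_comp_def orthogonal_commute)
  next
    fix y' assume y': "y' \<in> N \<and> x - y' \<in> orthogonal_comp N"
    have "y - y' \<in> N"
      using y' yz(1) span assms by (auto intro: subspace_diff)
    moreover have "y - y' \<in> orthogonal_comp N"
    proof -
      have "x - y \<in> orthogonal_comp N"
        using yz span by (auto simp: orthogonal_comp_def orthogonal_commute)
      then have "(x - y') - (x - y) \<in> orthogonal_comp N"
        using y' subspace_orthogonal_comp subspace_diff by blast
      then show ?thesis by simp
    qed
    ultimately show "y' = y"
      by (force simp: orthogonal_comp_def orthogonal_self)
  qed
  from theI'[OF this] show "orth_proj N x \<in> N" "x - orth_proj N x \<in> orthogonal_comp N"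
    unfolding orth_proj_def by auto
qed

lemma orth_proj_eqI:
  fixes N :: "'a::euclidean_space set"
  assumes "subspace N" "y \<in> N" "x - y \<in> orthogonal_comp N"
  shows "orth_proj N x = y"
proof -
  have "y - orth_proj N x \<in> N"
    using assms orth_proj_works[OF assms(1)] by (simp add: subspace_diff)
  moreover have "(x - orth_proj N x) - (x - y) \<in> orthogonal_comp N"
    using assms(3) orth_proj_works(2)[OF assms(1)] subspace_orthogonal_comp subspace_diff by blast
  ultimately have "orthogonal (y - orth_proj N x) (y - orth_proj N x)"
    by (auto simp: orthogonal_comp_def)
  then show ?thesis by (simp add: orthogonal_self)
qed

lemma linear_orth_proj:
  fixes N :: "'a::euclidean_space set"
  assumes "subspace N"
  shows "linear (orth_proj N)"
proof (rule linearI)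
  note P = orth_proj_works[OF assms]
  show "orth_proj N (x + y) = orth_proj N x + orth_proj N y" for x y
  proof (rule orth_proj_eqI[OF assms])
    have "(x - orth_proj N x) + (y - orth_proj N y) \<in> orthogonal_comp N"
      using P subspace_orthogonal_comp subspace_add by blast
    then show "x + y - (orth_proj N x + orth_proj N y) \<in> orthogonal_comp N"
      by (simp add: algebra_simps)
  qed (simp add: P subspace_add[OF assms])
  show "orth_proj N (r *\<^sub>R x) = r *\<^sub>R orth_proj N x" for r x
  proof (rule orth_proj_eqI[OF assms])
    have "r *\<^sub>R (x - orth_proj N x) \<in> orthogonal_comp N"
      using P subspace_orthogonal_comp subspace_scale by blast
    then show "r *\<^sub>R x - r *\<^sub>R orth_proj N x \<in> orthogonal_comp N"
      by (simp add: algebra_simps)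
  qed (simp add: P subspace_scale[OF assms])
qed

lemma inner_orth_proj:
  fixes N :: "'a::euclidean_space set"
  assumes "subspace N" "u \<in> N"
  shows "u \<bullet> orth_proj N x = u \<bullet> x"
proof -
  have "orthogonal u (x - orth_proj N x)"
    using orth_proj_works(2)[OF assms(1)] assms(2) by (auto simp: orthogonal_comp_def)
  then show ?thesis by (simp add: orthogonal_def inner_diff_right)
qed

section \<open>Parabolas\<close>

text \<open>
  The foot of the perpendicular from the origin is \<open>h e\<close>: every point of the translate has inner
  product \<open>h\<close> with \<open>e\<close>.
\<close>
lemma infdist_translate_subspace:
  fixes e :: "'a::euclidean_space"
  assumes W: "subspace W" "\<And>w. w \<in> W \<Longrightarrow> w \<bullet> e = 0"
    and e: "norm e = 1" and \<alpha>: "\<alpha> - h *\<^sub>R e \<in> W"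
  shows "infdist 0 ((+) \<alpha> ` W) = \<bar>h\<bar>"
proof (rule antisym)
  have "h *\<^sub>R e \<in> (+) \<alpha> ` W"
  proof (rule image_eqI)
    show "- (\<alpha> - h *\<^sub>R e) \<in> W" using W(1) \<alpha> by (rule subspace_neg)
  qed simp
  then show "infdist 0 ((+) \<alpha> ` W) \<le> \<bar>h\<bar>"
    by (rule infdist_le2) (simp add: e)
  have ee: "e \<bullet> e = 1" using e by (simp add: norm_eq_1)
  have "\<bar>h\<bar> \<le> dist 0 y" if "y \<in> (+) \<alpha> ` W" for y
  proof -
    obtain w where w: "w \<in> W" "y = \<alpha> + w" using \<open>y \<in> _\<close> by (auto simp: image_iff)
    have "y \<bullet> e = (\<alpha> - h *\<^sub>R e) \<bullet> e + w \<bullet> e + h"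
      using w ee by (simp add: inner_left_distrib inner_diff_left)
    then have "y \<bullet> e = h" using W(2)[OF \<alpha>] W(2)[OF w(1)] by simp
    then show ?thesis using Cauchy_Schwarz_ineq2[of y e] e by simp
  qed
  then show "\<bar>h\<bar> \<le> infdist 0 ((+) \<alpha> ` W)"
    using subspace_0[OF W(1)] by (subst infdist_notempty) (auto intro!: cINF_greatest)
qed

text \<open>
  The factor 2 makes \<open>\<alpha>\<close>, \<open>\<beta>\<close>, \<open>\<gamma>\<close> the entries of the matrix of the quadratic form whose values at
  \<open>a + t b\<close> trace out the parabola.
  Dependent \<open>\<beta>\<close>, \<open>\<gamma>\<close> give half-lines, lines and points.
\<close>
definition parabola :: "'a::real_vector \<Rightarrow> 'a \<Rightarrow> 'a \<Rightarrow> 'a set" where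
  "parabola \<alpha> \<beta> \<gamma> = {\<alpha> + (2 * t) *\<^sub>R \<beta> + t\<^sup>2 *\<^sub>R \<gamma> | t. True}"

text \<open>
  The differences of the points with parameters \<open>1\<close>, \<open>-1\<close> and \<open>0\<close> are \<open>\<plusminus> 2 \<beta> + \<gamma>\<close>, from which
  \<open>\<beta>\<close> and \<open>\<gamma>\<close> are recovered.
\<close>
lemma parabola_differences_in_subspace:
  assumes V: "subspace V" and diff: "\<And>x y. x \<in> parabola \<alpha> \<beta> \<gamma> \<Longrightarrow> y \<in> parabola \<alpha> \<beta> \<gamma> \<Longrightarrow> x - y \<in> V"
  shows "\<beta> \<in> V" "\<gamma> \<in> V"
proof -
  have mem: "\<alpha> + (2 * t) *\<^sub>R \<beta> + t\<^sup>2 *\<^sub>R \<gamma> \<in> parabola \<alpha> \<beta> \<gamma>" for t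
    unfolding parabola_def by blast
  have 1: "2 *\<^sub>R \<beta> + \<gamma> \<in> V" and 2: "- 2 *\<^sub>R \<beta> + \<gamma> \<in> V"
    using diff[OF mem mem, of 1 0] diff[OF mem mem, of "-1" 0] by simp_all
  have "(1/4) *\<^sub>R ((2 *\<^sub>R \<beta> + \<gamma>) - (- 2 *\<^sub>R \<beta> + \<gamma>)) \<in> V"
    by (intro subspace_scale subspace_diff V 1 2)
  moreover have "(1/4) *\<^sub>R ((2 *\<^sub>R \<beta> + \<gamma>) - (- 2 *\<^sub>R \<beta> + \<gamma>)) = \<beta>"
    by (simp add: scaleR_left_distrib[symmetric])
  ultimately show "\<beta> \<in> V" by simp
  have "(1/2) *\<^sub>R ((2 *\<^sub>R \<beta> + \<gamma>) + (- 2 *\<^sub>R \<beta> + \<gamma>)) \<in> V"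
    by (intro subspace_scale subspace_add V 1 2)
  then show "\<gamma> \<in> V" by (simp add: scaleR_2[symmetric])
qed

lemma affine_hull_parabola: "affine hull (parabola \<alpha> \<beta> \<gamma>) = (+) \<alpha> ` span {\<beta>, \<gamma>}"
proof -
  let ?T = "(\<lambda>x. - \<alpha> + x) ` parabola \<alpha> \<beta> \<gamma>"
  have \<alpha>: "\<alpha> \<in> parabola \<alpha> \<beta> \<gamma>"
    unfolding parabola_def by (auto intro: exI[of _ 0])
  have "span ?T = span {\<beta>, \<gamma>}"
  proof (rule span_eq[THEN iffD2], intro conjI subsetI)
    fix x assume "x \<in> ?T"
    then obtain t where "x = (2 * t) *\<^sub>R \<beta> + t\<^sup>2 *\<^sub>R \<gamma>"
      by (auto simp: parabola_def)
    then show "x \<in> span {\<beta>, \<gamma>}" using in_span_pair_iff by blast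
  next
    have "x - y \<in> span ?T" if "x \<in> parabola \<alpha> \<beta> \<gamma>" "y \<in> parabola \<alpha> \<beta> \<gamma>" for x y
      using span_diff[of "- \<alpha> + x" ?T "- \<alpha> + y"] that by (auto intro: span_base)
    then have "\<beta> \<in> span ?T" "\<gamma> \<in> span ?T"
      using parabola_differences_in_subspace[OF subspace_span] by blast+
    then show "x \<in> span ?T" if "x \<in> {\<beta>, \<gamma>}" for x using that by auto
  qed
  then show ?thesis
    using affine_hull_span_gen[OF hull_inc[OF \<alpha>]] by auto
qed

lemma umbilic_curvature_parabola:
  fixes e :: "'a::euclidean_space"
  assumes "norm e = 1" "\<beta> \<bullet> e = 0" "\<gamma> \<bullet> e = 0" "\<alpha> - h *\<^sub>R e \<in> span {\<beta>, \<gamma>}"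
  shows "infdist 0 (affine hull (parabola \<alpha> \<beta> \<gamma>)) = \<bar>h\<bar>"
  unfolding affine_hull_parabola
proof (rule infdist_translate_subspace)
  show "w \<bullet> e = 0" if "w \<in> span {\<beta>, \<gamma>}" for w
    using that assms by (auto simp: in_span_pair_iff inner_left_distrib)
qed (use assms in auto)

text \<open>
  If \<open>c = 0\<close>, the set is a line or a point and is closed under reflection of its points in each
  other; reflecting the second point \<open>a + d\<close> of a half-line in its end point \<open>a\<close> leaves it.
\<close>
lemma half_line_in_parabola_family:
  assumes "is_half_line (parabola \<alpha> (b *\<^sub>R e) (c *\<^sub>R e))"
  shows "c \<noteq> 0"
proof
  assume c: "c = 0"
  obtain a d where d: "d \<noteq> 0" and eq: "parabola \<alpha> (b *\<^sub>R e) (c *\<^sub>R e) = {a + t *\<^sub>R d | t. 0 \<le> t}"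
    using assms unfolding is_half_line_def by blast
  have mem: "z \<in> parabola \<alpha> (b *\<^sub>R e) (c *\<^sub>R e) \<longleftrightarrow> (\<exists>t. z = \<alpha> + (2 * t * b) *\<^sub>R e)" for z
    by (auto simp: parabola_def c)
  have "a \<in> parabola \<alpha> (b *\<^sub>R e) (c *\<^sub>R e)"
    unfolding eq by (auto intro: exI[of _ 0])
  then obtain t where t: "a = \<alpha> + (2 * t * b) *\<^sub>R e" unfolding mem by blast
  have "a + 1 *\<^sub>R d \<in> parabola \<alpha> (b *\<^sub>R e) (c *\<^sub>R e)"
    unfolding eq by (intro CollectI exI[of _ 1]) auto
  then obtain s where s: "a + 1 *\<^sub>R d = \<alpha> + (2 * s * b) *\<^sub>R e" unfolding mem by blast
  have "2 *\<^sub>R a - (a + 1 *\<^sub>R d) = \<alpha> + (2 * (2 * t - s) * b) *\<^sub>R e"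
    unfolding s by (simp add: t algebra_simps scaleR_2)
  then have "a - d = \<alpha> + (2 * (2 * t - s) * b) *\<^sub>R e" by (simp add: scaleR_2)
  then have "a - d \<in> parabola \<alpha> (b *\<^sub>R e) (c *\<^sub>R e)" unfolding mem by blast
  then obtain r where r: "0 \<le> r" "a - d = a + r *\<^sub>R d" unfolding eq by blast
  then have "(r + 1) *\<^sub>R d = 0" by (simp add: algebra_simps)
  with r(1) d show False by simp
qed

text \<open>
  If \<open>c \<noteq> 0\<close>, completing the square bounds the coordinate along \<open>e\<close> on one side, which is
  impossible on a line.
\<close>
lemma line_in_parabola_family:
  fixes e :: "'a::euclidean_space"
  assumes "is_line (parabola \<alpha> (b *\<^sub>R e) (c *\<^sub>R e))" and e: "norm e = 1"
  shows "c = 0" "b \<noteq> 0"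
proof -
  obtain a d where d: "d \<noteq> 0" and eq: "parabola \<alpha> (b *\<^sub>R e) (c *\<^sub>R e) = {a + t *\<^sub>R d | t. True}"
    using assms unfolding is_line_def by blast
  have ee: "e \<bullet> e = 1" using e by (simp add: norm_eq_1)
  have mem: "\<exists>s. a + t *\<^sub>R d = \<alpha> + (2 * s * b + s\<^sup>2 * c) *\<^sub>R e" for t
  proof -
    have "a + t *\<^sub>R d \<in> parabola \<alpha> (b *\<^sub>R e) (c *\<^sub>R e)" unfolding eq by blast
    then show ?thesis by (auto simp: parabola_def algebra_simps)
  qed
  obtain s0 where s0: "a = \<alpha> + (2 * s0 * b + s0\<^sup>2 * c) *\<^sub>R e" using mem[of 0] by auto
  obtain s1 where s1: "a + d = \<alpha> + (2 * s1 * b + s1\<^sup>2 * c) *\<^sub>R e" using mem[of 1] by auto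
  define \<delta> where "\<delta> = (2 * s1 * b + s1\<^sup>2 * c) - (2 * s0 * b + s0\<^sup>2 * c)"
  have "d = (a + d) - a" by simp
  also have "\<dots> = \<delta> *\<^sub>R e" unfolding s1 by (simp add: s0 \<delta>_def algebra_simps)
  finally have d\<delta>: "d = \<delta> *\<^sub>R e" .
  with d have \<delta>: "\<delta> \<noteq> 0" by auto
  show c: "c = 0"
  proof (rule ccontr)
    assume c: "c \<noteq> 0"
    define A where "A = (a - \<alpha>) \<bullet> e"
    have bound: "- b\<^sup>2 \<le> c * (A + t * \<delta>)" for t
    proof -
      obtain s where s: "a + t *\<^sub>R d = \<alpha> + (2 * s * b + s\<^sup>2 * c) *\<^sub>R e" using mem by blast
      have "A + t * \<delta> = (a + t *\<^sub>R d - \<alpha>) \<bullet> e"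
        by (simp add: A_def d\<delta> inner_diff_left inner_left_distrib ee)
      also have "\<dots> = 2 * s * b + s\<^sup>2 * c" unfolding s by (simp add: ee)
      finally have "c * (A + t * \<delta>) = (c * s + b)\<^sup>2 - b\<^sup>2"
        by (simp add: power2_eq_square algebra_simps)
      then show ?thesis by simp
    qed
    \<comment> \<open>The parameter on the line at which the bounded quantity would be \<open>- (b\<^sup>2 + 1)\<close>.\<close>
    have "c * (A + ((- (b\<^sup>2 + 1) / c - A) / \<delta>) * \<delta>) = - (b\<^sup>2 + 1)"
      using c \<delta> by simp
    with bound[of "(- (b\<^sup>2 + 1) / c - A) / \<delta>"] show False by simp
  qed
  show "b \<noteq> 0"
    using \<delta> by (auto simp: \<delta>_def c)
qed

text \<open>
  Full rank of the second fundamental form keeps the affine hull of the parabola away from the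
  origin and prevents the parabola from degenerating.
\<close>
lemma rank_3_parabola:
  fixes \<alpha> \<beta> \<gamma> :: "'a::euclidean_space"
  assumes "dim {\<alpha>, \<beta>, \<gamma>} = 3"
  shows "\<alpha> \<notin> span {\<beta>, \<gamma>}" "\<gamma> \<noteq> 0" "is_parabola (parabola \<alpha> \<beta> \<gamma>)"
proof -
  have "card {\<alpha>, \<beta>, \<gamma>} \<le> 3"
    by (simp add: card_insert_if)
  moreover have "dim {\<alpha>, \<beta>, \<gamma>} \<le> card {\<alpha>, \<beta>, \<gamma>}"
    by (rule dim_le_card') simp
  ultimately have card: "card {\<alpha>, \<beta>, \<gamma>} = 3" using assms by simp
  then have indep: "independent {\<alpha>, \<beta>, \<gamma>}"
    using assms by (intro card_le_dim_spanning[of _ "{\<alpha>, \<beta>, \<gamma>}"]) (auto intro: span_base)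
  have neq: "\<alpha> \<noteq> \<beta>" "\<alpha> \<noteq> \<gamma>" "\<beta> \<noteq> \<gamma>"
    using card by (auto simp: card_insert_if split: if_splits)
  from indep neq show "\<alpha> \<notin> span {\<beta>, \<gamma>}" by (simp add: independent_insert)
  from indep show "\<gamma> \<noteq> 0" using dependent_zero[of "{\<alpha>, \<beta>, \<gamma>}"] by auto
  have \<beta>: "\<beta> \<notin> span {\<gamma>}"
    using indep neq by (auto simp: independent_insert split: if_splits)
  have 2: "2 *\<^sub>R \<beta> \<notin> span {\<gamma>}"
  proof
    assume "2 *\<^sub>R \<beta> \<in> span {\<gamma>}"
    then have "(1/2) *\<^sub>R (2 *\<^sub>R \<beta>) \<in> span {\<gamma>}" by (rule span_scale)
    with \<beta> show False by simp
  qed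
  then have "2 *\<^sub>R \<beta> \<noteq> \<gamma>" by (auto intro: span_base)
  moreover have "independent {2 *\<^sub>R \<beta>, \<gamma>}"
    using 2 \<open>\<gamma> \<noteq> 0\<close> \<open>2 *\<^sub>R \<beta> \<noteq> \<gamma>\<close> by (simp add: independent_insert)
  moreover have "parabola \<alpha> \<beta> \<gamma> = {\<alpha> + t *\<^sub>R (2 *\<^sub>R \<beta>) + t\<^sup>2 *\<^sub>R \<gamma> | t. True}"
    by (simp add: parabola_def mult.commute)
  ultimately show "is_parabola (parabola \<alpha> \<beta> \<gamma>)"
    unfolding is_parabola_def by blast
qed

lemma rank_1_collinear:
  fixes \<alpha> \<beta> \<gamma> :: "'a::euclidean_space"
  assumes "dim {\<alpha>, \<beta>, \<gamma>} = 1" "\<gamma> \<noteq> 0"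
  shows "\<alpha> \<in> span {\<gamma>}"
proof (rule ccontr)
  assume \<alpha>: "\<alpha> \<notin> span {\<gamma>}"
  then have "\<alpha> \<noteq> \<gamma>" by (auto intro: span_base)
  with \<alpha> assms(2) have "card {\<alpha>, \<gamma>} \<le> dim {\<alpha>, \<beta>, \<gamma>}"
    by (intro independent_card_le_dim) (auto simp: independent_insert)
  with \<open>\<alpha> \<noteq> \<gamma>\<close> assms(1) show False by simp
qed

section \<open>Reduction to three normal vectors\<close>

text \<open>
  In the basis adapted to a corank 1 point, \<open>I - \<langle>u, II\<rangle>\<close> has the symmetric matrix with entries
  \<open>1 - u \<bullet> \<alpha>\<close>, \<open>- (u \<bullet> \<beta>)\<close>, \<open>- (u \<bullet> \<gamma>)\<close>.  Focal points are those where its determinant vanishes,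
  umbilical foci those where it vanishes itself; degenerate directions are the zeros of the
  determinant of \<open>\<langle>u, II\<rangle>\<close>.
\<close>
definition focal_locus :: "'a::real_inner set \<Rightarrow> 'a \<Rightarrow> 'a \<Rightarrow> 'a \<Rightarrow> 'a \<Rightarrow> 'a set" where
  "focal_locus N p \<alpha> \<beta> \<gamma> = {p + u | u. u \<in> N \<and> (u \<bullet> \<alpha> - 1) * (u \<bullet> \<gamma>) = (u \<bullet> \<beta>)\<^sup>2}"

definition umbilic_locus :: "'a::real_inner set \<Rightarrow> 'a \<Rightarrow> 'a \<Rightarrow> 'a \<Rightarrow> 'a \<Rightarrow> 'a set" where
  "umbilic_locus N p \<alpha> \<beta> \<gamma> = {p + u | u. u \<in> N \<and> u \<bullet> \<alpha> = 1 \<and> u \<bullet> \<beta> = 0 \<and> u \<bullet> \<gamma> = 0}"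

definition degenerate_cone :: "'a::real_inner set \<Rightarrow> 'a \<Rightarrow> 'a \<Rightarrow> 'a \<Rightarrow> 'a set" where
  "degenerate_cone N \<alpha> \<beta> \<gamma> = {u \<in> N. (u \<bullet> \<alpha>) * (u \<bullet> \<gamma>) = (u \<bullet> \<beta>)\<^sup>2}"

text \<open>
  The two equations differ by \<open>u \<bullet> \<gamma>\<close>, so both hold iff \<open>u \<bullet> \<gamma> = 0\<close> and hence \<open>u \<bullet> \<beta> = 0\<close>.
\<close>
lemma focal_inter_degenerate:
  "focal_locus N p \<alpha> \<beta> \<gamma> \<inter> (+) p ` degenerate_cone N \<alpha> \<beta> \<gamma>
    = {p + u | u. u \<in> N \<and> u \<bullet> \<beta> = 0 \<and> u \<bullet> \<gamma> = 0}"
  by (auto simp: focal_locus_def degenerate_cone_def left_diff_distrib)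

lemma smooth_surface_chartD:
  assumes "smooth_surface X \<A>" "c \<in> \<A>"
  shows "open (snd c ` fst c)" "inj_on (snd c) (fst c)"
proof -
  obtain U \<phi> where c: "c = (U, \<phi>)" by (cases c)
  have U: "openin X U" "open (\<phi> ` U)" "homeomorphic_map (subtopology X U) (top_of_set (\<phi> ` U)) \<phi>"
    using assms unfolding smooth_surface_def c by blast+
  then have "topspace (subtopology X U) = U"
    by (meson openin_subset topspace_subtopology_subset)
  with U homeomorphic_imp_injective_map[OF U(3)] show "open (snd c ` fst c)" "inj_on (snd c) (fst c)"
    by (auto simp: c)
qed

text \<open>
  This lemma turns the differential geometry into linear algebra: the sets compared in the
  theorem are expressed through the coefficients \<open>\<alpha> = II(a,a)\<close>, \<open>\<beta> = II(a,b)\<close>, \<open>\<gamma> = II(b,b)\<close> of the second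
  fundamental form in a basis adapted to the kernel of the differential.
\<close>
lemma corank1_second_order_data:
  fixes g :: "'m \<Rightarrow> real^4"
  assumes X: "smooth_surface X \<A>" and g: "smooth_map \<A> g"
    and c: "c \<in> \<A>" and q: "q \<in> fst c" and corank: "corank_at c g q = 1"
  obtains \<alpha> \<beta> \<gamma> where
    "\<alpha> \<in> normal_space_at c g q" "\<beta> \<in> normal_space_at c g q" "\<gamma> \<in> normal_space_at c g q"
    "curvature_parabola c g q = parabola \<alpha> \<beta> \<gamma>"
    "second_ff_rank c g q = dim {\<alpha>, \<beta>, \<gamma>}"
    "\<And>\<nu>. singular_at c (dist_sq g \<nu>) q \<longleftrightarrow> \<nu> \<in> (+) (g q) ` normal_space_at c g q"
    "focal_set c g q = focal_locus (normal_space_at c g q) (g q) \<alpha> \<beta> \<gamma>"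
    "umbilical_foci c g q = umbilic_locus (normal_space_at c g q) (g q) \<alpha> \<beta> \<gamma>"
    "degenerate_directions c g q = degenerate_cone (normal_space_at c g q) \<alpha> \<beta> \<gamma>"
proof -
  define S f x where "S = snd c ` fst c" and "f = in_chart c g" and "x = snd c q"
  define N where "N = normal_space_at c g q"
  have chart: "open S" "inj_on (snd c) (fst c)"
    using smooth_surface_chartD[OF X c] by (auto simp: S_def)
  have smooth: "smooth_on S f"
    using g c unfolding smooth_map_def S_def f_def by (cases c) fastforce
  interpret C2_at S f x
    using chart q smooth by unfold_locales (auto simp: S_def x_def smooth_on_def)
  have fx: "f x = g q"
    using chart(2) q by (simp add: f_def x_def in_chart_def inv_into_f_f)
  have diff: "diff_at c g q = D x"
    by (simp add: fun_eq_iff diff_at_def f_def x_def)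
  have diff2: "diff2_at c g q = D2"
    by (simp add: fun_eq_iff diff2_at_def f_def x_def)
  have dist: "in_chart c (dist_sq g \<nu>) = (\<lambda>y. (norm (f y - \<nu>))\<^sup>2)" for \<nu>
    by (simp add: fun_eq_iff in_chart_def dist_sq_def f_def)
  have N: "N = orthogonal_comp (range (D x))"
    by (simp add: N_def normal_space_at_def diff)
  have subN: "subspace N" unfolding N by (rule subspace_orthogonal_comp)
  define II where "II = second_ff c g q"
  have II: "II v w = orth_proj N (D2 v w)" for v w
    by (simp add: II_def second_ff_def N_def diff2)
  have II_N: "II v w \<in> N" for v w
    unfolding II using orth_proj_works(1)[OF subN] .
  have bilII: "bilinear II"
    unfolding bilinear_def
  proof (intro conjI allI)
    show "linear (\<lambda>w. II v w)" for v
      using linear_compose[OF _ linear_orth_proj[OF subN], of "D2 v"] bilinear_D2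
      by (simp add: o_def II bilinear_def)
    show "linear (\<lambda>v. II v w)" for w
      using linear_compose[OF _ linear_orth_proj[OF subN], of "\<lambda>v. D2 v w"] bilinear_D2
      by (simp add: o_def II bilinear_def)
  qed
  have symII: "II v w = II w v" for v w
    by (simp add: II D2_symmetric[of v w])
  have linD: "linear (D x)" using linear_D[OF x_in] .
  have "dim (range (D x)) = 1"
    using corank by (simp add: corank_at_def diff)
  then obtain a b where ab: "norm (D x a) = 1" "D x b = 0" "b \<noteq> 0"
      "\<And>v. \<exists>x y. v = x *\<^sub>R a + y *\<^sub>R b"
    using rank1_adapted_basis[OF linD] by blast
  have Dxy: "D x (s *\<^sub>R a + t *\<^sub>R b) = s *\<^sub>R D x a" for s t
    using ab(2) by (simp add: linear_add[OF linD] linear_scale[OF linD])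
  interpret plane_basis a b
  proof
    show "s = 0 \<and> t = 0" if "s *\<^sub>R a + t *\<^sub>R b = 0" for s t
    proof -
      have "s *\<^sub>R D x a = 0"
        using Dxy[of s t] that linear_0[OF linD] by simp
      moreover have "D x a \<noteq> 0" using ab(1) by auto
      ultimately have "s = 0" by simp
      with that ab(3) show ?thesis by simp
    qed
  qed (rule ab(4))
  have DD: "D x a \<bullet> D x a = 1" using ab(1) by (simp add: norm_eq_1)
  define \<alpha> \<beta> \<gamma> where "\<alpha> = II a a" and "\<beta> = II a b" and "\<gamma> = II b b"
  have IIxy: "II (s *\<^sub>R a + t *\<^sub>R b) (s' *\<^sub>R a + t' *\<^sub>R b)
      = (s * s') *\<^sub>R \<alpha> + (s * t' + t * s') *\<^sub>R \<beta> + (t * t') *\<^sub>R \<gamma>" for s t s' t'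
    unfolding bilinear_coordinates[OF bilII] symII[of b a] \<alpha>_def \<beta>_def \<gamma>_def
    by (simp add: algebra_simps)

  have parab: "curvature_parabola c g q = parabola \<alpha> \<beta> \<gamma>"
  proof (intro set_eqI iffI)
    fix z assume "z \<in> curvature_parabola c g q"
    then obtain w where w: "z = II w w" "D x w \<bullet> D x w = 1"
      by (auto simp: curvature_parabola_def II_def first_ff_def diff)
    obtain s t where st: "w = s *\<^sub>R a + t *\<^sub>R b" using coordinates by blast
    have ss: "s * s = 1" using w(2) unfolding st Dxy by (simp add: DD)
    \<comment> \<open>Since \<open>s = \<plusminus> 1\<close>, the parameter on the parabola is \<open>s t = t / s\<close>.\<close>
    have "(s * t)\<^sup>2 = t * t" using ss by algebra
    then have "z = \<alpha> + (2 * (s * t)) *\<^sub>R \<beta> + (s * t)\<^sup>2 *\<^sub>R \<gamma>"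
      unfolding w st IIxy using ss by (simp add: mult.commute)
    then show "z \<in> parabola \<alpha> \<beta> \<gamma>" unfolding parabola_def by blast
  next
    fix z assume "z \<in> parabola \<alpha> \<beta> \<gamma>"
    then obtain t where "z = \<alpha> + (2 * t) *\<^sub>R \<beta> + t\<^sup>2 *\<^sub>R \<gamma>" unfolding parabola_def by blast
    then have "z = II (1 *\<^sub>R a + t *\<^sub>R b) (1 *\<^sub>R a + t *\<^sub>R b)"
      unfolding IIxy by (simp add: power2_eq_square)
    moreover have "first_ff c g q (1 *\<^sub>R a + t *\<^sub>R b) (1 *\<^sub>R a + t *\<^sub>R b) = 1"
      unfolding first_ff_def diff Dxy by (simp add: DD)
    ultimately show "z \<in> curvature_parabola c g q"
      unfolding curvature_parabola_def II_def by blast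
  qed

  have "span {II v w | v w. True} = span {\<alpha>, \<beta>, \<gamma>}"
  proof (rule span_eq[THEN iffD2], intro conjI subsetI)
    fix z assume "z \<in> {II v w | v w. True}"
    then obtain v w where z: "z = II v w" by blast
    obtain s t s' t' where "v = s *\<^sub>R a + t *\<^sub>R b" "w = s' *\<^sub>R a + t' *\<^sub>R b"
      using coordinates by metis
    then show "z \<in> span {\<alpha>, \<beta>, \<gamma>}"
      unfolding z by (simp add: IIxy span_add span_scale span_base)
  qed (auto simp: \<alpha>_def \<beta>_def \<gamma>_def intro!: span_base)
  then have rank: "second_ff_rank c g q = dim {\<alpha>, \<beta>, \<gamma>}"
    by (simp add: second_ff_rank_def II_def)

  have sing: "singular_at c (dist_sq g \<nu>) q \<longleftrightarrow> \<nu> \<in> (+) (g q) ` N" for \<nu>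
  proof -
    have "singular_at c (dist_sq g \<nu>) q \<longleftrightarrow> (\<forall>v. (g q - \<nu>) \<bullet> D x v = 0)"
      unfolding singular_at_def diff_at_def dist x_def[symmetric] dist_sq_D[OF x_in] by (simp add: fx)
    also have "\<dots> \<longleftrightarrow> \<nu> - g q \<in> N"
      by (auto simp: N orthogonal_comp_def orthogonal_def inner_diff_left inner_diff_right inner_commute)
    also have "\<dots> \<longleftrightarrow> \<nu> \<in> (+) (g q) ` N"
      by (auto simp: image_iff algebra_simps) (metis add_diff_cancel_left' diff_add_cancel)
    finally show ?thesis .
  qed

  have at_normal_points: "{\<nu>. singular_at c (dist_sq g \<nu>) q \<and> P \<nu>} = {g q + u | u. u \<in> N \<and> P (g q + u)}" for P
    unfolding sing by blast

  \<comment> \<open>Against a normal vector the second derivative and its normal part have the same inner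
    product, so \<open>II\<close> may replace the second derivative in the Hessian.\<close>
  define H where "H u v w = 2 * (D x v \<bullet> D x w - u \<bullet> II v w)" for u v w
  have hess: "diff2_at c (dist_sq g (g q + u)) q v w = H u v w" if "u \<in> N" for u v w
    unfolding diff2_at_def dist x_def[symmetric] dist_sq_D2 H_def II inner_orth_proj[OF subN that]
    by (simp add: fx)
  have bilH: "bilinear (H u)" for u
    unfolding bilinear_def
    by (intro conjI allI linearI;
        simp add: H_def linear_add[OF linD] linear_scale[OF linD] bilinear_ladd[OF bilII]
          bilinear_radd[OF bilII] bilinear_lmul[OF bilII] bilinear_rmul[OF bilII]
          inner_left_distrib inner_right_distrib algebra_simps)
  have symH: "H u b a = H u a b" for u
    by (simp add: H_def inner_commute symII[of b a])
  have Hab: "H u a a = 2 * (1 - u \<bullet> \<alpha>)" "H u a b = - 2 * (u \<bullet> \<beta>)" "H u b b = - 2 * (u \<bullet> \<gamma>)" for u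
    using ab by (simp_all add: H_def DD \<alpha>_def \<beta>_def \<gamma>_def)
  have ker: "hessian_kernel c (dist_sq g (g q + u)) q = {v. \<forall>w. H u v w = 0}" if "u \<in> N" for u
    unfolding hessian_kernel_def by (simp add: hess[OF that])

  have foc: "focal_set c g q = focal_locus N (g q) \<alpha> \<beta> \<gamma>"
  proof -
    have "{v. \<forall>w. H u v w = 0} \<noteq> {0} \<longleftrightarrow> (u \<bullet> \<alpha> - 1) * (u \<bullet> \<gamma>) = (u \<bullet> \<beta>)\<^sup>2" for u
    proof -
      have "{v. \<forall>w. H u v w = 0} \<noteq> {0} \<longleftrightarrow> (\<exists>v. v \<noteq> 0 \<and> (\<forall>w. H u v w = 0))"
        using bilinear_lzero[OF bilH] by auto
      also have "\<dots> \<longleftrightarrow> 4 * ((u \<bullet> \<alpha> - 1) * (u \<bullet> \<gamma>)) = 4 * (u \<bullet> \<beta>)\<^sup>2"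
        unfolding ex_bilinear_kernel_iff[OF bilH symH] Hab
        by (simp add: power2_eq_square algebra_simps)
      finally show ?thesis by simp
    qed
    then show ?thesis
      unfolding focal_set_def focal_locus_def at_normal_points by (simp add: ker cong: conj_cong)
  qed

  have umb: "umbilical_foci c g q = umbilic_locus N (g q) \<alpha> \<beta> \<gamma>"
  proof -
    have "dim {v. \<forall>w. H u v w = 0} = 2 \<longleftrightarrow> u \<bullet> \<alpha> = 1 \<and> u \<bullet> \<beta> = 0 \<and> u \<bullet> \<gamma> = 0" for u
      unfolding dim_bilinear_kernel_eq_2_iff[OF bilH symH] Hab by auto
    then show ?thesis
      unfolding umbilical_foci_def umbilic_locus_def at_normal_points by (simp add: ker cong: conj_cong)
  qed

  have deg: "degenerate_directions c g q = degenerate_cone N \<alpha> \<beta> \<gamma>"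
  proof -
    define G where "G u v w = II v w \<bullet> u" for u v w
    have bilG: "bilinear (G u)" for u
      unfolding bilinear_def
      by (intro conjI allI linearI;
          simp add: G_def bilinear_ladd[OF bilII] bilinear_radd[OF bilII] bilinear_lmul[OF bilII]
            bilinear_rmul[OF bilII] inner_left_distrib)
    have symG: "G u b a = G u a b" for u by (simp add: G_def symII[of b a])
    have "(\<exists>v. v \<noteq> 0 \<and> (\<forall>w. G u v w = 0)) \<longleftrightarrow> (u \<bullet> \<alpha>) * (u \<bullet> \<gamma>) = (u \<bullet> \<beta>)\<^sup>2" for u
      unfolding ex_bilinear_kernel_iff[OF bilG symG]
      by (simp add: G_def \<alpha>_def \<beta>_def \<gamma>_def inner_commute)
    then show ?thesis
      unfolding degenerate_directions_def degenerate_cone_def second_ff_along_def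
      by (simp add: G_def II_def N_def)
  qed

  show thesis
    by (rule that[of \<alpha> \<beta> \<gamma>])
       (use parab rank sing foc umb deg II_N in \<open>auto simp: N_def \<alpha>_def \<beta>_def \<gamma>_def\<close>)
qed

section \<open>The loci in an orthonormal frame\<close>

text \<open>
  A hyperplane of the ambient space whose normal vector lies in the three-dimensional space \<open>N\<close>
  cannot contain \<open>N\<close>, nor be disjoint from it.
\<close>
lemma is_plane_hyperplane_section:
  fixes N :: "'a::euclidean_space set"
  assumes N: "subspace N" "dim N = 3" and n: "n \<in> N" "n \<noteq> 0"
  shows "is_plane {p + u | u. u \<in> N \<and> u \<bullet> n = r}"
proof -
  let ?P = "N \<inter> {u. n \<bullet> u = r}"
  have eq: "{p + u | u. u \<in> N \<and> u \<bullet> n = r} = (+) p ` ?P"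
    by (auto simp: inner_commute)
  have nn: "n \<bullet> n \<noteq> 0" using n by simp
  have "(r / (n \<bullet> n)) *\<^sub>R n \<in> ?P"
    using nn N n by (simp add: subspace_scale)
  then have "?P \<noteq> {}" by blast
  moreover have "((r + 1) / (n \<bullet> n)) *\<^sub>R n \<in> N - {u. n \<bullet> u = r}"
    using nn N n by (simp add: subspace_scale)
  then have "\<not> N \<subseteq> {u. n \<bullet> u = r}" by blast
  moreover have "aff_dim N = 3"
    using N by (simp add: aff_dim_subspace)
  ultimately have "aff_dim ?P = 2"
    using aff_dim_affine_Int_hyperplane[OF subspace_imp_affine[OF N(1)], of n r] by simp
  moreover have "affine ?P"
    using N(1) by (intro affine_Int subspace_imp_affine affine_hyperplane)
  ultimately show ?thesis
    unfolding eq is_plane_def by (simp add: aff_dim_translation_eq affine_translation[symmetric])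
qed

text \<open>
  The plane \<open>E\<close> is given only as a subspace parallel to the affine hull of the parabola; this
  identifies it as \<open>span {\<beta>, \<gamma>}\<close>.
\<close>
lemma affine_parallel_subspace_translate:
  assumes "subspace E" "subspace W" "affine_parallel E ((+) a ` W)"
  shows "E = W"
proof -
  have "affine_parallel ((+) a ` W) W"
    using affine_parallel_commute unfolding affine_parallel_def by blast
  with assms have "affine_parallel E W"
    using affine_parallel_assoc by blast
  then show ?thesis using parallel_subspace[OF assms(1,2)] by blast
qed

locale orthonormal_frame =
  fixes e2 e3 e4 :: "'a::euclidean_space"
  assumes unit: "norm e2 = 1" "norm e3 = 1" "norm e4 = 1"
    and orth: "e2 \<bullet> e3 = 0" "e2 \<bullet> e4 = 0" "e3 \<bullet> e4 = 0"
begin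

definition N :: "'a set" where "N = span {e2, e3, e4}"

lemma inner_frame [simp]:
  "e2 \<bullet> e2 = 1" "e3 \<bullet> e3 = 1" "e4 \<bullet> e4 = 1" "e2 \<bullet> e3 = 0" "e3 \<bullet> e2 = 0"
  "e2 \<bullet> e4 = 0" "e4 \<bullet> e2 = 0" "e3 \<bullet> e4 = 0" "e4 \<bullet> e3 = 0"
  using unit orth by (simp_all add: norm_eq_1 inner_commute)

lemma e2_nonzero: "e2 \<noteq> 0"
  using unit(1) by auto

lemma subspace_N: "subspace N" by (simp add: N_def)

lemma frame_in_N [simp]: "e2 \<in> N" "e3 \<in> N" "e4 \<in> N"
  by (simp_all add: N_def span_base)

lemma comb_in_N [simp]: "x *\<^sub>R e2 + y *\<^sub>R e3 + z *\<^sub>R e4 \<in> N"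
  by (intro subspace_add subspace_scale subspace_N frame_in_N)

lemma N_coordinates:
  assumes "u \<in> N"
  shows "u = (u \<bullet> e2) *\<^sub>R e2 + (u \<bullet> e3) *\<^sub>R e3 + (u \<bullet> e4) *\<^sub>R e4"
proof -
  obtain x where "u - x *\<^sub>R e2 \<in> span {e3, e4}"
    using assms unfolding N_def span_insert[of e2] by blast
  then obtain y z where "u - x *\<^sub>R e2 = y *\<^sub>R e3 + z *\<^sub>R e4"
    using in_span_pair_iff by blast
  then have "u = x *\<^sub>R e2 + y *\<^sub>R e3 + z *\<^sub>R e4" by (simp add: algebra_simps)
  then show ?thesis by (simp add: inner_left_distrib)
qed

lemma in_N_iff: "u \<in> N \<longleftrightarrow> (\<exists>x y z. u = x *\<^sub>R e2 + y *\<^sub>R e3 + z *\<^sub>R e4)"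
  using N_coordinates comb_in_N by metis

lemma dim_N: "dim N = 3"
proof -
  have "e2 \<noteq> e3" "e2 \<noteq> e4" "e3 \<noteq> e4"
    using inner_frame by (metis zero_neq_one)+
  moreover have "independent {e2, e3, e4}"
    using unit by (intro pairwise_orthogonal_independent)
      (auto simp: pairwise_def orthogonal_def)
  ultimately show ?thesis
    by (simp add: N_def dim_eq_card_independent)
qed

text \<open>
  The case of a non-degenerate parabola.  Its affine hull lies at height \<open>h\<close> over the plane spanned
  by \<open>e2\<close> and \<open>e3\<close>.
\<close>
context
  fixes p \<alpha> \<beta> \<gamma> :: 'a and h :: real
  assumes \<alpha>: "\<alpha> \<in> N" and h: "h = \<alpha> \<bullet> e4" "h \<noteq> 0" and span: "span {\<beta>, \<gamma>} = span {e2, e3}"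
begin

lemma orthogonal_to_base_iff: "u \<bullet> \<beta> = 0 \<and> u \<bullet> \<gamma> = 0 \<longleftrightarrow> u \<bullet> e2 = 0 \<and> u \<bullet> e3 = 0"
proof -
  have "(u \<bullet> x = 0 \<and> u \<bullet> y = 0) = (\<forall>w\<in>span {x, y}. u \<bullet> w = 0)" for x y
    by (auto simp: in_span_pair_iff inner_right_distrib intro: span_base)
  then show ?thesis using span by metis
qed

lemma parabola_normal_line: "{p + u | u. u \<in> N \<and> u \<bullet> \<beta> = 0 \<and> u \<bullet> \<gamma> = 0} = {p + r *\<^sub>R e4 | r. True}"
  unfolding orthogonal_to_base_iff
proof (intro set_eqI iffI)
  fix x assume "x \<in> {p + u | u. u \<in> N \<and> u \<bullet> e2 = 0 \<and> u \<bullet> e3 = 0}"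
  then obtain u where u: "x = p + u" "u \<in> N" "u \<bullet> e2 = 0" "u \<bullet> e3 = 0" by blast
  then have "x = p + (u \<bullet> e4) *\<^sub>R e4" using N_coordinates[OF u(2)] by simp
  then show "x \<in> {p + r *\<^sub>R e4 | r. True}" by blast
next
  fix x assume "x \<in> {p + r *\<^sub>R e4 | r. True}"
  then obtain r where "x = p + r *\<^sub>R e4" by blast
  moreover have "r *\<^sub>R e4 \<in> N" by (simp add: subspace_scale[OF subspace_N])
  ultimately show "x \<in> {p + u | u. u \<in> N \<and> u \<bullet> e2 = 0 \<and> u \<bullet> e3 = 0}" by auto
qed

text \<open>
  The quadratic part of the focal equation is \<open>(u \<bullet> \<alpha>) (u \<bullet> \<gamma>) - (u \<bullet> \<beta>)\<^sup>2\<close>.  It does not vanish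
  on \<open>N\<close>: moving from \<open>u = \<gamma>\<close> along \<open>e4\<close> changes only the factor \<open>u \<bullet> \<alpha>\<close>.
\<close>
lemma parabola_focal_quadric:
  assumes "\<gamma> \<noteq> 0"
  shows "is_quadric N p (focal_locus N p \<alpha> \<beta> \<gamma>)"
  unfolding is_quadric_def
proof (intro exI conjI)
  let ?B = "\<lambda>x y. (x \<bullet> \<alpha>) * (y \<bullet> \<gamma>) - (x \<bullet> \<beta>) * (y \<bullet> \<beta>)"
  show "bilinear ?B"
    unfolding bilinear_def
    by (auto intro!: linearI simp: inner_left_distrib algebra_simps)
  \<comment> \<open>Chosen such that the quadratic part takes the value 1 at \<open>\<gamma> + t e4\<close>.\<close>
  define t where "t = ((1 + (\<gamma> \<bullet> \<beta>)\<^sup>2) / (\<gamma> \<bullet> \<gamma>) - \<gamma> \<bullet> \<alpha>) / h"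
  have base: "\<gamma> \<in> span {e2, e3}"
    unfolding span[symmetric] by (auto intro: span_base)
  have e4: "e4 \<bullet> \<beta> = 0" "e4 \<bullet> \<gamma> = 0" using orthogonal_to_base_iff[of e4] by simp_all
  have "?B (\<gamma> + t *\<^sub>R e4) (\<gamma> + t *\<^sub>R e4) = (\<gamma> \<bullet> \<alpha> + t * h) * (\<gamma> \<bullet> \<gamma>) - (\<gamma> \<bullet> \<beta>)\<^sup>2"
    using e4 by (simp add: inner_left_distrib h(1) inner_commute[of \<alpha> e4] power2_eq_square)
  also have "\<gamma> \<bullet> \<alpha> + t * h = (1 + (\<gamma> \<bullet> \<beta>)\<^sup>2) / (\<gamma> \<bullet> \<gamma>)"
    using h by (simp add: t_def)
  finally have "?B (\<gamma> + t *\<^sub>R e4) (\<gamma> + t *\<^sub>R e4) = 1"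
    using assms by simp
  moreover have "\<gamma> + t *\<^sub>R e4 \<in> N"
    using base span_mono[of "{e2, e3}" "{e2, e3, e4}"]
    by (intro subspace_add subspace_scale subspace_N) (auto simp: N_def intro: span_base)
  ultimately show "\<exists>u\<in>N. ?B u u \<noteq> 0" by (metis zero_neq_one)
  show "focal_locus N p \<alpha> \<beta> \<gamma> = {p + u | u. u \<in> N \<and> ?B u u + (- \<gamma>) \<bullet> u + 0 = 0}"
    unfolding focal_locus_def by (simp add: algebra_simps power2_eq_square inner_commute)
qed

lemma parabola_focal_inter_degenerate:
  "focal_locus N p \<alpha> \<beta> \<gamma> \<inter> (+) p ` degenerate_cone N \<alpha> \<beta> \<gamma> = {p + r *\<^sub>R e4 | r. True}"
  unfolding focal_inter_degenerate by (rule parabola_normal_line)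

lemma parabola_umbilic_locus: "umbilic_locus N p \<alpha> \<beta> \<gamma> = {p + (1 / h) *\<^sub>R e4}"
proof -
  have "u \<in> N \<and> u \<bullet> \<alpha> = 1 \<and> u \<bullet> \<beta> = 0 \<and> u \<bullet> \<gamma> = 0 \<longleftrightarrow> u = (1 / h) *\<^sub>R e4" for u
  proof
    assume u: "u \<in> N \<and> u \<bullet> \<alpha> = 1 \<and> u \<bullet> \<beta> = 0 \<and> u \<bullet> \<gamma> = 0"
    then have u4: "u = (u \<bullet> e4) *\<^sub>R e4"
      using N_coordinates[of u] orthogonal_to_base_iff[of u] by simp
    have "u \<bullet> \<alpha> = (u \<bullet> e4) * h"
      by (subst u4) (simp add: h(1) inner_commute)
    with u h(2) have "u \<bullet> e4 = 1 / h" by (simp add: field_simps)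
    with u4 show "u = (1 / h) *\<^sub>R e4" by metis
  next
    assume u: "u = (1 / h) *\<^sub>R e4"
    have "u \<bullet> \<beta> = 0 \<and> u \<bullet> \<gamma> = 0" unfolding orthogonal_to_base_iff by (simp add: u)
    moreover have "u \<bullet> \<alpha> = 1" using h by (simp add: u inner_commute)
    moreover have "u \<in> N" by (simp add: u subspace_scale[OF subspace_N])
    ultimately show "u \<in> N \<and> u \<bullet> \<alpha> = 1 \<and> u \<bullet> \<beta> = 0 \<and> u \<bullet> \<gamma> = 0" by blast
  qed
  then show ?thesis unfolding umbilic_locus_def by auto
qed

lemma parabola_umbilic_curvature: "infdist 0 (affine hull (parabola \<alpha> \<beta> \<gamma>)) = \<bar>h\<bar>"
proof (rule umbilic_curvature_parabola)
  show "norm e4 = 1" by (rule unit)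
  show "\<beta> \<bullet> e4 = 0" "\<gamma> \<bullet> e4 = 0"
    using orthogonal_to_base_iff[of e4] by (simp_all add: inner_commute)
  have "\<alpha> - h *\<^sub>R e4 = (\<alpha> \<bullet> e2) *\<^sub>R e2 + (\<alpha> \<bullet> e3) *\<^sub>R e3"
    using N_coordinates[OF \<alpha>] h(1) by (simp add: algebra_simps)
  then show "\<alpha> - h *\<^sub>R e4 \<in> span {\<beta>, \<gamma>}"
    unfolding span using in_span_pair_iff by blast
qed

end

text \<open>
  The case of a parabola that degenerates to a line or a half-line in the direction \<open>e2\<close>, lying in
  the plane of \<open>e2\<close> and \<open>e3\<close> at height \<open>h\<close>.
\<close>
context
  fixes p :: 'a and k h b c :: real
begin

lemma collinear_umbilic_curvature:
  assumes "b \<noteq> 0 \<or> c \<noteq> 0"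
  shows "infdist 0 (affine hull (parabola (k *\<^sub>R e2 + h *\<^sub>R e3) (b *\<^sub>R e2) (c *\<^sub>R e2))) = \<bar>h\<bar>"
proof (rule umbilic_curvature_parabola)
  have "e2 \<in> span {b *\<^sub>R e2, c *\<^sub>R e2}"
  proof (cases "b = 0")
    case True
    with assms have "e2 = 0 *\<^sub>R (b *\<^sub>R e2) + (1 / c) *\<^sub>R (c *\<^sub>R e2)" by simp
    then show ?thesis using in_span_pair_iff by blast
  next
    case False
    then have "e2 = (1 / b) *\<^sub>R (b *\<^sub>R e2) + 0 *\<^sub>R (c *\<^sub>R e2)" by simp
    then show ?thesis using in_span_pair_iff by blast
  qed
  then show "k *\<^sub>R e2 + h *\<^sub>R e3 - h *\<^sub>R e3 \<in> span {b *\<^sub>R e2, c *\<^sub>R e2}"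
    by (simp add: span_scale)
qed (simp_all add: unit)

lemma collinear_umbilic_locus:
  assumes "b \<noteq> 0 \<or> c \<noteq> 0" "h \<noteq> 0"
  shows "umbilic_locus N p (k *\<^sub>R e2 + h *\<^sub>R e3) (b *\<^sub>R e2) (c *\<^sub>R e2)
    = {p + (1 / h) *\<^sub>R e3 + r *\<^sub>R e4 | r. True}" (is "?U = ?l")
proof (intro set_eqI iffI)
  fix x assume "x \<in> ?U"
  then obtain u where u: "x = p + u" "u \<in> N" "k * (u \<bullet> e2) + h * (u \<bullet> e3) = 1"
      "b * (u \<bullet> e2) = 0" "c * (u \<bullet> e2) = 0"
    by (auto simp: umbilic_locus_def inner_right_distrib)
  then have "u \<bullet> e2 = 0" using assms(1) by auto
  moreover from this u(3) have "u \<bullet> e3 = 1 / h" using assms(2) by (simp add: field_simps)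
  ultimately have "x = p + (1 / h) *\<^sub>R e3 + (u \<bullet> e4) *\<^sub>R e4"
    using N_coordinates[OF u(2)] u(1) by (simp add: add.assoc)
  then show "x \<in> ?l" by blast
next
  fix x assume "x \<in> ?l"
  then obtain r where x: "x = p + (1 / h) *\<^sub>R e3 + r *\<^sub>R e4" by blast
  let ?u = "0 *\<^sub>R e2 + (1 / h) *\<^sub>R e3 + r *\<^sub>R e4"
  have "x = p + ?u" by (simp add: x add.assoc)
  moreover have "?u \<in> N" by (rule comb_in_N)
  moreover have "?u \<bullet> (k *\<^sub>R e2 + h *\<^sub>R e3) = 1" "?u \<bullet> (b *\<^sub>R e2) = 0" "?u \<bullet> (c *\<^sub>R e2) = 0"
    using assms(2) by (simp_all add: inner_left_distrib inner_right_distrib)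
  ultimately show "x \<in> ?U" unfolding umbilic_locus_def by blast
qed

lemma collinear_focal_inter_degenerate:
  assumes "b \<noteq> 0 \<or> c \<noteq> 0"
  shows "focal_locus N p (k *\<^sub>R e2 + h *\<^sub>R e3) (b *\<^sub>R e2) (c *\<^sub>R e2)
      \<inter> (+) p ` degenerate_cone N (k *\<^sub>R e2 + h *\<^sub>R e3) (b *\<^sub>R e2) (c *\<^sub>R e2)
    = {p + u | u. u \<in> N \<and> u \<bullet> e2 = 0}"
  unfolding focal_inter_degenerate using assms by auto

lemma line_focal_locus:
  assumes "b \<noteq> 0" "c = 0"
  shows "focal_locus N p (k *\<^sub>R e2 + h *\<^sub>R e3) (b *\<^sub>R e2) (c *\<^sub>R e2)
    = (+) p ` degenerate_cone N (k *\<^sub>R e2 + h *\<^sub>R e3) (b *\<^sub>R e2) (c *\<^sub>R e2)"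
  unfolding focal_locus_def degenerate_cone_def using assms by auto

text \<open>
  The focal equation is divisible by \<open>u \<bullet> e2\<close> because \<open>\<beta>\<close> and \<open>\<gamma>\<close> are both multiples of \<open>e2\<close>.
  The vector \<open>\<alpha> - (b\<^sup>2 / c) e2\<close> in the other factor is the end point of the half-line.
\<close>
lemma half_line_focal_locus:
  assumes "c \<noteq> 0"
  shows "focal_locus N p (k *\<^sub>R e2 + h *\<^sub>R e3) (b *\<^sub>R e2) (c *\<^sub>R e2)
    = {p + u | u. u \<in> N \<and> u \<bullet> e2 = 0} \<union>
      {p + u | u. u \<in> N \<and> u \<bullet> ((k - b\<^sup>2 / c) *\<^sub>R e2 + h *\<^sub>R e3) = 1}"
proof -
  have "(u \<bullet> (k *\<^sub>R e2 + h *\<^sub>R e3) - 1) * (u \<bullet> (c *\<^sub>R e2)) = (u \<bullet> (b *\<^sub>R e2))\<^sup>2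
      \<longleftrightarrow> u \<bullet> e2 = 0 \<or> u \<bullet> ((k - b\<^sup>2 / c) *\<^sub>R e2 + h *\<^sub>R e3) = 1" for u
  proof -
    have "(u \<bullet> (k *\<^sub>R e2 + h *\<^sub>R e3) - 1) * (u \<bullet> (c *\<^sub>R e2)) - (u \<bullet> (b *\<^sub>R e2))\<^sup>2
        = c * (u \<bullet> e2) * (u \<bullet> ((k - b\<^sup>2 / c) *\<^sub>R e2 + h *\<^sub>R e3) - 1)"
      using assms by (simp add: inner_right_distrib field_simps power2_eq_square)
    then show ?thesis using assms by auto
  qed
  then show ?thesis unfolding focal_locus_def by blast
qed

text \<open>
  The first plane contributes the directions \<open>e3\<close> and \<open>e4\<close>, the second one contributes
  \<open>e2 - (m / h) e3\<close>.
\<close>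
lemma transverse_planes:
  fixes m :: real
  assumes "h \<noteq> 0"
  defines "P \<equiv> {p + u | u. u \<in> N \<and> u \<bullet> e2 = 0}"
    and "Q \<equiv> {p + u | u. u \<in> N \<and> u \<bullet> (m *\<^sub>R e2 + h *\<^sub>R e3) = 1}"
  shows "transverse_in N P Q" "P \<inter> Q = {p + (1 / h) *\<^sub>R e3 + r *\<^sub>R e4 | r. True}"
proof -
  have P: "p + (x *\<^sub>R e2 + y *\<^sub>R e3 + z *\<^sub>R e4) \<in> P \<longleftrightarrow> x = 0" for x y z
    unfolding P_def using comb_in_N[of x y z] by (auto simp: inner_left_distrib)
  have Q: "p + (x *\<^sub>R e2 + y *\<^sub>R e3 + z *\<^sub>R e4) \<in> Q \<longleftrightarrow> m * x + h * y = 1" for x y z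
    unfolding Q_def using comb_in_N[of x y z]
    by (auto simp: inner_left_distrib inner_right_distrib)
  let ?D = "{x - y | x y. x \<in> P \<and> y \<in> P} \<union> {x - y | x y. x \<in> Q \<and> y \<in> Q}"
  have "span ?D \<subseteq> N"
  proof (rule span_minimal[OF _ subspace_N])
    show "?D \<subseteq> N"
      unfolding P_def Q_def by (auto intro: subspace_diff[OF subspace_N])
  qed
  moreover have "N \<subseteq> span ?D"
  proof -
    have PP: "x - y \<in> span ?D" if "x \<in> P" "y \<in> P" for x y using that by (blast intro: span_base)
    have QQ: "x - y \<in> span ?D" if "x \<in> Q" "y \<in> Q" for x y using that by (blast intro: span_base)
    have "e3 \<in> span ?D" "e4 \<in> span ?D"
      using PP[OF P[THEN iffD2, of 0 1 0] P[THEN iffD2, of 0 0 0]]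
        PP[OF P[THEN iffD2, of 0 0 1] P[THEN iffD2, of 0 0 0]] by simp_all
    moreover have "e2 - (m / h) *\<^sub>R e3 \<in> span ?D"
      using QQ[OF Q[THEN iffD2, of 1 "(1 - m) / h" 0] Q[THEN iffD2, of 0 "1 / h" 0]] assms
      by (simp add: diff_divide_distrib algebra_simps)
    then have "(e2 - (m / h) *\<^sub>R e3) + (m / h) *\<^sub>R e3 \<in> span ?D"
      using \<open>e3 \<in> span ?D\<close> by (intro span_add span_scale)
    ultimately have "{e2, e3, e4} \<subseteq> span ?D" by simp
    then show ?thesis unfolding N_def by (intro span_minimal) auto
  qed
  ultimately show "transverse_in N P Q" unfolding transverse_in_def by blast
  show "P \<inter> Q = {p + (1 / h) *\<^sub>R e3 + r *\<^sub>R e4 | r. True}"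
  proof (intro set_eqI iffI)
    fix v assume v: "v \<in> P \<inter> Q"
    then obtain x y z where xyz: "v = p + (x *\<^sub>R e2 + y *\<^sub>R e3 + z *\<^sub>R e4)"
      using in_N_iff by (auto simp: P_def)
    from v have "v \<in> P" "v \<in> Q" by auto
    then have "x = 0" "m * x + h * y = 1"
      unfolding xyz P Q .
    then have "x = 0" "y = 1 / h" using assms(1) by (simp_all add: field_simps)
    with xyz show "v \<in> {p + (1 / h) *\<^sub>R e3 + r *\<^sub>R e4 | r. True}" by (auto simp: add.assoc)
  next
    fix v assume "v \<in> {p + (1 / h) *\<^sub>R e3 + r *\<^sub>R e4 | r. True}"
    then obtain r where "v = p + (0 *\<^sub>R e2 + (1 / h) *\<^sub>R e3 + r *\<^sub>R e4)" by (auto simp: add.assoc)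
    with P[of 0 "1/h" r] Q[of 0 "1/h" r] assms(1) show "v \<in> P \<inter> Q" by auto
  qed
qed

end

text \<open>
  Both factors of the focal equation depend on \<open>u \<bullet> e2\<close> only.  If the half-line ends at the
  origin, which is the case \<open>m = 0\<close>, the second factor has no zeros and the two planes coincide.
\<close>
lemma radial_half_line_focal_locus:
  assumes "c \<noteq> 0"
  shows "\<exists>P Q. is_plane P \<and> is_plane Q \<and> P \<subseteq> (+) p ` N \<and> Q \<subseteq> (+) p ` N \<and> affine_parallel P Q \<and>
    focal_locus N p (k *\<^sub>R e2) (b *\<^sub>R e2) (c *\<^sub>R e2) = P \<union> Q"
proof -
  define m where "m = k - b\<^sup>2 / c"
  define P where "P = {p + u | u. u \<in> N \<and> u \<bullet> e2 = 0}"
  define Q where "Q = {p + u | u. u \<in> N \<and> u \<bullet> (m *\<^sub>R e2) = 1}"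
  have foc: "focal_locus N p (k *\<^sub>R e2) (b *\<^sub>R e2) (c *\<^sub>R e2) = P \<union> Q"
    using half_line_focal_locus[OF assms, of p k 0 b] unfolding P_def Q_def m_def by simp
  have P: "is_plane P" "P \<subseteq> (+) p ` N"
    using is_plane_hyperplane_section[OF subspace_N dim_N frame_in_N(1) e2_nonzero]
    by (auto simp: P_def)
  show ?thesis
  proof (cases "m = 0")
    case True
    then have "Q = {}" by (simp add: Q_def)
    moreover have "affine_parallel P P"
      unfolding affine_parallel_def by (rule exI[of _ 0]) simp
    ultimately show ?thesis using foc P by (intro exI[of _ P]) simp
  next
    case False
    have "is_plane Q" "Q \<subseteq> (+) p ` N"
      using is_plane_hyperplane_section[OF subspace_N dim_N, of "m *\<^sub>R e2" p 1] e2_nonzero False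
      by (auto simp: Q_def subspace_scale[OF subspace_N])
    moreover have "affine_parallel P Q"
      unfolding affine_parallel_def
    proof (intro exI set_eqI iffI)
      fix v assume "v \<in> Q"
      then obtain u where u: "v = p + u" "u \<in> N" "m * (u \<bullet> e2) = 1" by (auto simp: Q_def)
      then have "p + (u - (1 / m) *\<^sub>R e2) \<in> P"
        using False unfolding P_def
        by (intro CollectI exI[of _ "u - (1 / m) *\<^sub>R e2"])
           (auto simp: inner_diff_left field_simps intro!: subspace_diff subspace_N subspace_scale)
      moreover have "v = (1 / m) *\<^sub>R e2 + (p + (u - (1 / m) *\<^sub>R e2))" by (simp add: u)
      ultimately show "v \<in> (+) ((1 / m) *\<^sub>R e2) ` P" by blast
    next
      fix v assume "v \<in> (+) ((1 / m) *\<^sub>R e2) ` P"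
      then obtain u where u: "v = (1 / m) *\<^sub>R e2 + (p + u)" "u \<in> N" "u \<bullet> e2 = 0"
        by (auto simp: P_def)
      then show "v \<in> Q"
        using False unfolding Q_def
        by (intro CollectI exI[of _ "(1 / m) *\<^sub>R e2 + u"])
           (auto simp: inner_left_distrib intro!: subspace_add subspace_N subspace_scale)
    qed
    ultimately show ?thesis using foc P by blast
  qed
qed

lemma point_umbilic_locus:
  assumes "h \<noteq> 0"
  shows "umbilic_locus N p (h *\<^sub>R e3) 0 0 = {p + t *\<^sub>R e2 + (1 / h) *\<^sub>R e3 + r *\<^sub>R e4 | t r. True}"
    (is "?U = ?l")
proof (intro set_eqI iffI)
  fix x assume "x \<in> ?U"
  then obtain u where u: "x = p + u" "u \<in> N" "h * (u \<bullet> e3) = 1"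
    by (auto simp: umbilic_locus_def)
  then have "u \<bullet> e3 = 1 / h" using assms by (simp add: field_simps)
  then have "x = p + (u \<bullet> e2) *\<^sub>R e2 + (1 / h) *\<^sub>R e3 + (u \<bullet> e4) *\<^sub>R e4"
    using N_coordinates[OF u(2)] u(1) by (simp add: add.assoc)
  then show "x \<in> ?l" by blast
next
  fix x assume "x \<in> ?l"
  then obtain t r where x: "x = p + t *\<^sub>R e2 + (1 / h) *\<^sub>R e3 + r *\<^sub>R e4" by blast
  let ?u = "t *\<^sub>R e2 + (1 / h) *\<^sub>R e3 + r *\<^sub>R e4"
  have "x = p + ?u" by (simp add: x add.assoc)
  moreover have "?u \<in> N" by (rule comb_in_N)
  moreover have "?u \<bullet> (h *\<^sub>R e3) = 1" using assms by (simp add: inner_left_distrib)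
  ultimately show "x \<in> ?U" unfolding umbilic_locus_def by (auto intro!: exI[of _ ?u])
qed

end

section \<open>Focal set and umbilical foci\<close>

theorem theorem5p1:
  fixes X :: "'m topology" and \<A> :: "'m chart set"
    and g :: "'m \<Rightarrow> real^4" and q :: 'm and p :: "real^4" and c :: "'m chart"
    and E :: "(real^4) set" and \<nu>2 \<nu>3 \<nu>4 :: "real^4"
  defines "N \<equiv> normal_space_at c g q"
    and "\<Delta> \<equiv> curvature_parabola c g q"
    and "\<kappa> \<equiv> umbilic_curvature c g q"
    and "Deg \<equiv> (+) p ` degenerate_directions c g q"
  assumes "smooth_surface X \<A>" and "smooth_map \<A> g"
    and "c \<in> \<A>" and "q \<in> fst c"
    and "corank_at c g q = 1" and "g q = p"
    and "is_E_plane c g q E" and "adapted_frame c g q E \<nu>2 \<nu>3 \<nu>4"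
  shows "(\<forall>\<nu>. singular_at c (dist_sq g \<nu>) q \<longleftrightarrow> \<nu> \<in> (+) p ` N) \<and>

    (second_ff_rank c g q = 3 \<longrightarrow>
       is_quadric N p (focal_set c g q) \<and>
       focal_set c g q \<inter> Deg = {p + r *\<^sub>R \<nu>4 | r. True} \<and>
       (\<exists>s\<in>{-1, 1}. (\<forall>x\<in>\<Delta>. 0 < s * (x \<bullet> \<nu>4)) \<and>
          umbilical_foci c g q = {p + (s / \<kappa>) *\<^sub>R \<nu>4} \<and>
          p + (s / \<kappa>) *\<^sub>R \<nu>4 \<in> (+) p ` E_perp c g q E)) \<and>

    (second_ff_rank c g q = 2 \<and> semiumbilic c g q \<longrightarrow>
       (\<exists>s\<in>{-1, 1}. (\<forall>x\<in>\<Delta>. 0 < s * (x \<bullet> \<nu>3)) \<and>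
         (let l = {p + (s / \<kappa>) *\<^sub>R \<nu>3 + r *\<^sub>R \<nu>4 | r. True} in
           (is_half_line \<Delta> \<longrightarrow>
              (\<exists>P Q. is_plane P \<and> is_plane Q \<and> P \<subseteq> (+) p ` N \<and> Q \<subseteq> (+) p ` N \<and>
                 transverse_in N P Q \<and> focal_set c g q = P \<union> Q \<and> P \<inter> Q = l) \<and>
              umbilical_foci c g q = l) \<and>
           (is_line \<Delta> \<longrightarrow>
              focal_set c g q = Deg \<and>
              umbilical_foci c g q = l))) \<and>
       (+) p ` E_perp c g q E \<subseteq> focal_set c g q \<inter> Deg \<and>
       focal_set c g q \<inter> Deg = (+) p ` span {\<nu>3, \<nu>4}) \<and>

    (second_ff_rank c g q = 1 \<and> is_half_line \<Delta> \<longrightarrow>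
       (\<exists>P Q. is_plane P \<and> is_plane Q \<and> P \<subseteq> (+) p ` N \<and> Q \<subseteq> (+) p ` N \<and>
          affine_parallel P Q \<and> focal_set c g q = P \<union> Q)) \<and>

    (second_ff_rank c g q = 1 \<and> umbilic_non_flat c g q \<longrightarrow>
       focal_set c g q = (+) p ` N \<and>
       umbilical_foci c g q = {p + t *\<^sub>R \<nu>2 + (1 / \<kappa>) *\<^sub>R \<nu>3 + r *\<^sub>R \<nu>4 | t r. True})"
proof -
  obtain \<alpha> \<beta> \<gamma> where data: "\<alpha> \<in> N" "\<beta> \<in> N" "\<gamma> \<in> N" "\<Delta> = parabola \<alpha> \<beta> \<gamma>"
      "second_ff_rank c g q = dim {\<alpha>, \<beta>, \<gamma>}"
      "\<And>\<nu>. singular_at c (dist_sq g \<nu>) q \<longleftrightarrow> \<nu> \<in> (+) p ` N"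
      "focal_set c g q = focal_locus N p \<alpha> \<beta> \<gamma>"
      "umbilical_foci c g q = umbilic_locus N p \<alpha> \<beta> \<gamma>"
      "degenerate_directions c g q = degenerate_cone N \<alpha> \<beta> \<gamma>"
    using corank1_second_order_data[OF assms(5-9)] unfolding assms(10) N_def \<Delta>_def by blast
  note \<Delta> = data(4)
  have Deg: "Deg = (+) p ` degenerate_cone N \<alpha> \<beta> \<gamma>"
    by (simp add: Deg_def data(9))
  have frame: "norm \<nu>2 = 1" "norm \<nu>3 = 1" "norm \<nu>4 = 1" "\<nu>2 \<bullet> \<nu>3 = 0" "\<nu>2 \<bullet> \<nu>4 = 0" "\<nu>3 \<bullet> \<nu>4 = 0"
      "span {\<nu>2, \<nu>3, \<nu>4} = N" "span {\<nu>2, \<nu>3} = E" "\<nu>4 \<in> E_perp c g q E"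
    and frame_line: "is_line \<Delta> \<or> is_half_line \<Delta> \<Longrightarrow> x \<in> \<Delta> \<Longrightarrow> y \<in> \<Delta> \<Longrightarrow> x - y \<in> span {\<nu>2}"
    and frame_point: "\<Delta> = {a} \<Longrightarrow> a \<noteq> 0 \<Longrightarrow> \<nu>3 = sgn a" for x y a
    using assms(12) unfolding adapted_frame_def Let_def \<Delta>_def N_def by blast+
  have E: "subspace E"
    and E_parabola: "is_parabola \<Delta> \<Longrightarrow> affine_parallel E (affine hull \<Delta>)"
    and E_line: "is_half_line \<Delta> \<or> is_line \<Delta> \<Longrightarrow> affine hull \<Delta> \<subseteq> E"
    using assms(11) unfolding is_E_plane_def Let_def \<Delta>_def by blast+
  interpret F: orthonormal_frame \<nu>2 \<nu>3 \<nu>4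
    using frame by unfold_locales
  have FN: "F.N = N" by (simp add: F.N_def frame(7))
  have \<kappa>: "\<kappa> = infdist 0 (affine hull parabola \<alpha> \<beta> \<gamma>)"
    by (simp add: \<kappa>_def umbilic_curvature_def \<Delta>[unfolded \<Delta>_def])
  have \<Delta>_inner: "x \<bullet> e = \<alpha> \<bullet> e" if "x \<in> \<Delta>" "\<beta> \<bullet> e = 0" "\<gamma> \<bullet> e = 0" for x e
    using that unfolding \<Delta> parabola_def by (auto simp: inner_left_distrib)
  \<comment> \<open>The sign with which the frame vector has to be multiplied to point towards the parabola.\<close>
  have sign: "sgn h \<in> {-1, 1} \<and> 0 < sgn h * h \<and> sgn h / \<bar>h\<bar> = 1 / h" if "h \<noteq> 0" for h :: real
    using that by (auto simp: sgn_if abs_if)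
  have rank3: "is_quadric N p (focal_set c g q) \<and>
       focal_set c g q \<inter> Deg = {p + r *\<^sub>R \<nu>4 | r. True} \<and>
       (\<exists>s\<in>{-1, 1}. (\<forall>x\<in>\<Delta>. 0 < s * (x \<bullet> \<nu>4)) \<and>
          umbilical_foci c g q = {p + (s / \<kappa>) *\<^sub>R \<nu>4} \<and>
          p + (s / \<kappa>) *\<^sub>R \<nu>4 \<in> (+) p ` E_perp c g q E)"
    if "second_ff_rank c g q = 3"
  proof -
    have rank: "dim {\<alpha>, \<beta>, \<gamma>} = 3" using that data(5) by simp
    note gen = rank_3_parabola[OF rank]
    have "affine_parallel E ((+) \<alpha> ` span {\<beta>, \<gamma>})"
      using E_parabola gen(3) unfolding \<Delta> affine_hull_parabola by blast
    then have "E = span {\<beta>, \<gamma>}"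
      using affine_parallel_subspace_translate[OF E subspace_span] by blast
    with frame(8) have span: "span {\<beta>, \<gamma>} = span {\<nu>2, \<nu>3}" by simp
    define h where "h = \<alpha> \<bullet> \<nu>4"
    have "h \<noteq> 0"
    proof
      assume "h = 0"
      then have "\<alpha> = (\<alpha> \<bullet> \<nu>2) *\<^sub>R \<nu>2 + (\<alpha> \<bullet> \<nu>3) *\<^sub>R \<nu>3"
        using F.N_coordinates[of \<alpha>] data(1) by (simp add: FN h_def)
      then have "\<alpha> \<in> span {\<nu>2, \<nu>3}" using in_span_pair_iff by blast
      with gen(1) span show False by simp
    qed
    have \<alpha>F: "\<alpha> \<in> F.N" using data(1) FN by simp
    note case_facts = \<alpha>F h_def \<open>h \<noteq> 0\<close> span
    have \<kappa>h: "\<kappa> = \<bar>h\<bar>"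
      using F.parabola_umbilic_curvature[OF case_facts] \<kappa> by simp
    have base: "\<beta> \<bullet> \<nu>4 = 0" "\<gamma> \<bullet> \<nu>4 = 0"
      using F.orthogonal_to_base_iff[OF case_facts, of \<nu>4] by (simp_all add: inner_commute)
    have sk: "sgn h / \<kappa> = 1 / h" using sign[OF \<open>h \<noteq> 0\<close>] by (simp add: \<kappa>h)
    have "subspace (E_perp c g q E)"
      unfolding E_perp_def normal_space_at_def
      by (intro subspace_inter subspace_orthogonal_comp)
    then have "(sgn h / \<kappa>) *\<^sub>R \<nu>4 \<in> E_perp c g q E"
      using frame(9) by (rule subspace_scale)
    moreover have "\<forall>x\<in>\<Delta>. 0 < sgn h * (x \<bullet> \<nu>4)"
      using \<Delta>_inner base sign[OF \<open>h \<noteq> 0\<close>] by (auto simp: h_def)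
    moreover have "umbilical_foci c g q = {p + (sgn h / \<kappa>) *\<^sub>R \<nu>4}"
      unfolding sk data(8) using F.parabola_umbilic_locus[OF case_facts] FN by simp
    moreover have "is_quadric N p (focal_set c g q)"
      unfolding data(7) using F.parabola_focal_quadric[OF case_facts gen(2)] FN by simp
    moreover have "focal_set c g q \<inter> Deg = {p + r *\<^sub>R \<nu>4 | r. True}"
      unfolding data(7) Deg using F.parabola_focal_inter_degenerate[OF case_facts] FN by simp
    ultimately show ?thesis using sign[OF \<open>h \<noteq> 0\<close>] by blast
  qed
  have collinear: "\<exists>b c. \<beta> = b *\<^sub>R \<nu>2 \<and> \<gamma> = c *\<^sub>R \<nu>2" if "is_line \<Delta> \<or> is_half_line \<Delta>"
    using parabola_differences_in_subspace[OF subspace_span, of \<alpha> \<beta> \<gamma> "{\<nu>2}"]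
      frame_line[OF that] unfolding \<Delta> by (auto simp: span_singleton)
  have rank2: "(\<exists>s\<in>{-1, 1}. (\<forall>x\<in>\<Delta>. 0 < s * (x \<bullet> \<nu>3)) \<and>
         (let l = {p + (s / \<kappa>) *\<^sub>R \<nu>3 + r *\<^sub>R \<nu>4 | r. True} in
           (is_half_line \<Delta> \<longrightarrow>
              (\<exists>P Q. is_plane P \<and> is_plane Q \<and> P \<subseteq> (+) p ` N \<and> Q \<subseteq> (+) p ` N \<and>
                 transverse_in N P Q \<and> focal_set c g q = P \<union> Q \<and> P \<inter> Q = l) \<and>
              umbilical_foci c g q = l) \<and>
           (is_line \<Delta> \<longrightarrow>
              focal_set c g q = Deg \<and>
              umbilical_foci c g q = l))) \<and>
       (+) p ` E_perp c g q E \<subseteq> focal_set c g q \<inter> Deg \<and>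
       focal_set c g q \<inter> Deg = (+) p ` span {\<nu>3, \<nu>4}"
    if "semiumbilic c g q"
  proof -
    have shape: "is_half_line \<Delta> \<or> is_line \<Delta>" and nonradial: "\<not> is_radial \<Delta>"
      using that by (auto simp: semiumbilic_def \<Delta>_def)
    obtain b d where \<beta>: "\<beta> = b *\<^sub>R \<nu>2" and \<gamma>: "\<gamma> = d *\<^sub>R \<nu>2"
      using collinear shape by blast
    have "\<alpha> \<in> affine hull \<Delta>"
      unfolding \<Delta> affine_hull_parabola by (rule image_eqI[of _ _ 0]) (simp_all add: span_zero)
    then obtain k h where \<alpha>: "\<alpha> = k *\<^sub>R \<nu>2 + h *\<^sub>R \<nu>3"
      using E_line[OF shape] frame(8) in_span_pair_iff by blast
    have "h \<noteq> 0"
    proof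
      assume "h = 0"
      then have "\<Delta> \<subseteq> span {\<nu>2}"
        unfolding \<Delta> parabola_def \<alpha> \<beta> \<gamma> by (auto simp: span_singleton simp flip: scaleR_left_distrib)
      moreover have "\<nu>2 \<noteq> 0" by (rule F.e2_nonzero)
      ultimately show False using nonradial unfolding is_radial_def by blast
    qed
    have half: "d \<noteq> 0" if "is_half_line \<Delta>"
      using half_line_in_parabola_family that unfolding \<Delta> \<beta> \<gamma> by blast
    have line: "d = 0 \<and> b \<noteq> 0" if "is_line \<Delta>"
      using line_in_parabola_family[OF _ frame(1)] that unfolding \<Delta> \<beta> \<gamma> by blast
    have bd: "b \<noteq> 0 \<or> d \<noteq> 0" using shape half line by blast
    have \<kappa>h: "\<kappa> = \<bar>h\<bar>"
      using F.collinear_umbilic_curvature[OF bd] \<kappa> unfolding \<alpha> \<beta> \<gamma> by simp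
    have sk: "sgn h / \<kappa> = 1 / h" using sign[OF \<open>h \<noteq> 0\<close>] by (simp add: \<kappa>h)
    define l where "l = {p + (1 / h) *\<^sub>R \<nu>3 + r *\<^sub>R \<nu>4 | r. True}"
    have umb: "umbilical_foci c g q = l"
      unfolding data(8) l_def \<alpha> \<beta> \<gamma> FN[symmetric] by (rule F.collinear_umbilic_locus[OF bd \<open>h \<noteq> 0\<close>])
    have pos: "\<forall>x\<in>\<Delta>. 0 < sgn h * (x \<bullet> \<nu>3)"
    proof
      fix x assume "x \<in> \<Delta>"
      then have "x \<bullet> \<nu>3 = h" using \<Delta>_inner[of x \<nu>3] by (simp add: \<alpha> \<beta> \<gamma> inner_left_distrib)
      then show "0 < sgn h * (x \<bullet> \<nu>3)" using sign[OF \<open>h \<noteq> 0\<close>] by simp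
    qed
    have half_case: "\<exists>P Q. is_plane P \<and> is_plane Q \<and> P \<subseteq> (+) p ` N \<and> Q \<subseteq> (+) p ` N \<and>
                 transverse_in N P Q \<and> focal_set c g q = P \<union> Q \<and> P \<inter> Q = l"
      if "is_half_line \<Delta>"
    proof -
      define n where "n = (k - b\<^sup>2 / d) *\<^sub>R \<nu>2 + h *\<^sub>R \<nu>3"
      have "n \<bullet> \<nu>3 = h" by (simp add: n_def inner_left_distrib)
      with \<open>h \<noteq> 0\<close> have "n \<noteq> 0" by auto
      have "n \<in> F.N"
        unfolding n_def by (intro subspace_add subspace_scale F.subspace_N F.frame_in_N)
      note plane = is_plane_hyperplane_section[OF F.subspace_N F.dim_N]
      have "is_plane {p + u | u. u \<in> N \<and> u \<bullet> \<nu>2 = 0}" "is_plane {p + u | u. u \<in> N \<and> u \<bullet> n = 1}"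
        using plane[OF F.frame_in_N(1) F.e2_nonzero, of p 0] plane[OF \<open>n \<in> F.N\<close> \<open>n \<noteq> 0\<close>, of p 1]
        by (simp_all add: FN)
      moreover have "focal_set c g q = {p + u | u. u \<in> N \<and> u \<bullet> \<nu>2 = 0} \<union> {p + u | u. u \<in> N \<and> u \<bullet> n = 1}"
        unfolding data(7) \<alpha> \<beta> \<gamma> n_def FN[symmetric] using F.half_line_focal_locus[OF half[OF that]] .
      moreover have "transverse_in N {p + u | u. u \<in> N \<and> u \<bullet> \<nu>2 = 0} {p + u | u. u \<in> N \<and> u \<bullet> n = 1}"
          "{p + u | u. u \<in> N \<and> u \<bullet> \<nu>2 = 0} \<inter> {p + u | u. u \<in> N \<and> u \<bullet> n = 1} = l"
        unfolding n_def FN[symmetric] l_def using F.transverse_planes[OF \<open>h \<noteq> 0\<close>] by blast+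
      moreover have "{p + u | u. u \<in> N \<and> u \<bullet> \<nu>2 = 0} \<subseteq> (+) p ` N"
          "{p + u | u. u \<in> N \<and> u \<bullet> n = 1} \<subseteq> (+) p ` N"
        by blast+
      ultimately show ?thesis by (intro exI conjI)
    qed
    have line_case: "focal_set c g q = Deg" if "is_line \<Delta>"
      unfolding data(7) Deg \<alpha> \<beta> \<gamma> FN[symmetric] using F.line_focal_locus line[OF that] by blast
    have inter: "focal_set c g q \<inter> Deg = {p + u | u. u \<in> N \<and> u \<bullet> \<nu>2 = 0}"
      unfolding data(7) Deg \<alpha> \<beta> \<gamma> FN[symmetric] by (rule F.collinear_focal_inter_degenerate[OF bd])
    have "u \<in> N \<and> u \<bullet> \<nu>2 = 0 \<longleftrightarrow> u \<in> span {\<nu>3, \<nu>4}" for u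
    proof
      assume u: "u \<in> N \<and> u \<bullet> \<nu>2 = 0"
      then have "u = (u \<bullet> \<nu>3) *\<^sub>R \<nu>3 + (u \<bullet> \<nu>4) *\<^sub>R \<nu>4"
        using F.N_coordinates[of u] by (simp add: FN)
      then show "u \<in> span {\<nu>3, \<nu>4}" using in_span_pair_iff by blast
    next
      assume "u \<in> span {\<nu>3, \<nu>4}"
      then obtain r s where "u = r *\<^sub>R \<nu>3 + s *\<^sub>R \<nu>4" using in_span_pair_iff by blast
      then show "u \<in> N \<and> u \<bullet> \<nu>2 = 0"
        using F.comb_in_N[of 0 r s] by (simp add: FN inner_left_distrib)
    qed
    then have "focal_set c g q \<inter> Deg = (+) p ` span {\<nu>3, \<nu>4}"
      unfolding inter by blast
    moreover have "(+) p ` E_perp c g q E \<subseteq> focal_set c g q \<inter> Deg"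
    proof -
      have "\<nu>2 \<in> E" unfolding frame(8)[symmetric] by (simp add: span_base)
      then have "u \<in> N \<and> u \<bullet> \<nu>2 = 0" if "u \<in> E_perp c g q E" for u
        using that unfolding E_perp_def N_def orthogonal_comp_def orthogonal_def
        by (auto simp: inner_commute)
      then show ?thesis unfolding inter by blast
    qed
    moreover have "\<exists>s\<in>{-1, 1}. (\<forall>x\<in>\<Delta>. 0 < s * (x \<bullet> \<nu>3)) \<and>
         (let l = {p + (s / \<kappa>) *\<^sub>R \<nu>3 + r *\<^sub>R \<nu>4 | r. True} in
           (is_half_line \<Delta> \<longrightarrow>
              (\<exists>P Q. is_plane P \<and> is_plane Q \<and> P \<subseteq> (+) p ` N \<and> Q \<subseteq> (+) p ` N \<and>
                 transverse_in N P Q \<and> focal_set c g q = P \<union> Q \<and> P \<inter> Q = l) \<and>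
              umbilical_foci c g q = l) \<and>
           (is_line \<Delta> \<longrightarrow>
              focal_set c g q = Deg \<and>
              umbilical_foci c g q = l))"
      unfolding Let_def
    proof (rule bexI[of _ "sgn h"])
      show "sgn h \<in> {-1, 1}" using sign[OF \<open>h \<noteq> 0\<close>] by blast
    qed (unfold sk l_def[symmetric], use pos half_case line_case umb in blast)
    ultimately show ?thesis by blast
  qed
  have rank1_half: "\<exists>P Q. is_plane P \<and> is_plane Q \<and> P \<subseteq> (+) p ` N \<and> Q \<subseteq> (+) p ` N \<and>
          affine_parallel P Q \<and> focal_set c g q = P \<union> Q"
    if rank: "second_ff_rank c g q = 1" and half: "is_half_line \<Delta>"
  proof -
    obtain b d where \<beta>: "\<beta> = b *\<^sub>R \<nu>2" and \<gamma>: "\<gamma> = d *\<^sub>R \<nu>2"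
      using collinear half by blast
    have "d \<noteq> 0"
      using half_line_in_parabola_family half unfolding \<Delta> \<beta> \<gamma> by blast
    then have "\<gamma> \<noteq> 0" using frame(1) unfolding \<gamma> by auto
    then have "\<alpha> \<in> span {\<gamma>}"
      using rank_1_collinear rank data(5) by metis
    then obtain r where \<alpha>: "\<alpha> = (r * d) *\<^sub>R \<nu>2" by (auto simp: span_singleton \<gamma>)
    show ?thesis
      unfolding data(7) \<alpha> \<beta> \<gamma> FN[symmetric] by (rule F.radial_half_line_focal_locus[OF \<open>d \<noteq> 0\<close>])
  qed
  have rank1_point: "focal_set c g q = (+) p ` N \<and>
       umbilical_foci c g q = {p + t *\<^sub>R \<nu>2 + (1 / \<kappa>) *\<^sub>R \<nu>3 + r *\<^sub>R \<nu>4 | t r. True}"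
    if umbilic: "umbilic_non_flat c g q"
  proof -
    obtain a where a: "a \<noteq> 0" "\<Delta> = {a}"
      using umbilic by (auto simp: umbilic_non_flat_def \<Delta>_def)
    have "\<beta> \<in> {0}" "\<gamma> \<in> {0}"
      using parabola_differences_in_subspace[of "{0}" \<alpha> \<beta> \<gamma>] a(2) unfolding \<Delta> by auto
    then have \<beta>\<gamma>: "\<beta> = 0" "\<gamma> = 0" by auto
    have "\<Delta> = {\<alpha>}" unfolding \<Delta> parabola_def \<beta>\<gamma> by auto
    with a(2) have "\<alpha> = a" by auto
    also have "a = norm a *\<^sub>R sgn a"
      using a(1) by (simp add: sgn_div_norm)
    finally have \<alpha>: "\<alpha> = norm a *\<^sub>R \<nu>3"
      using frame_point[OF a(2,1)] by simp
    have "\<kappa> = norm a"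
      unfolding \<kappa> \<Delta>[symmetric] a(2) by simp
    then have "umbilical_foci c g q = {p + t *\<^sub>R \<nu>2 + (1 / \<kappa>) *\<^sub>R \<nu>3 + r *\<^sub>R \<nu>4 | t r. True}"
      using F.point_umbilic_locus[of "norm a" p] a(1) unfolding data(8) \<beta>\<gamma> \<alpha> FN by simp
    moreover have "focal_set c g q = (+) p ` N"
      unfolding data(7) \<beta>\<gamma> focal_locus_def by auto
    ultimately show ?thesis by blast
  qed
  show ?thesis
    by (rule conjI, rule allI, rule data(6), rule conjI, rule impI, erule rank3,
        rule conjI, rule impI, rule rank2, erule conjunct2,
        rule conjI, rule impI, elim conjE, erule (1) rank1_half,
        rule impI, rule rank1_point, erule conjunct2)
qed

end
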